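(* Let $n\ge 1$ and let $\mathbb{X}\subseteq \mathbb{P}^1\times\mathbb{P}^n$ be a nonempty finite set of points. If $\mathbb{X}$ satisfies property $(\star)$, then $\mathbb{X}$ is arithmetically Cohen-Macaulay.
   Context: $k$ is an algebraically closed field of characteristic zero, and projective spaces are over $k$. The coordinate ring of $\mathbb{P}^1\times\mathbb{P}^n$ is the $\mathbb{N}^2$-graded ring $R=k[x_0,x_1,y_0,\ldots,y_n]$ with $\deg x_i=(1,0)$ and $\deg y_j=(0,1)$. For a finite set of points $\mathbb{X}\subseteq\mathbb{P}^1\times\mathbb{P}^n$, $I_{\mathbb{X}}\subseteq R$ is the ideal generated by all bihomogeneous forms that vanish at all points of $\mathbb{X}$. The set $\mathbb{X}$ is arithmetically Cohen-Macaulay (ACM) if $\dim R/I_{\mathbb{X}}=\operatorname{depth} R/I_{\mathbb{X}}=2$, i.e. $R/I_{\mathbb{X}}$ is a Cohen-Macaulay ring; here depth is taken with respect to the ideal generated by all the variables. A set of points $\mathbb{X}\subseteq\mathbb{P}^1\times\mathbb{P}^n$ satisfies property $(\star)$ if whenever $P_1\times Q_1$ and $P_2\times Q_2$ are two points of $\mathbb{X}$ (with $P_1,P_2\in\mathbb{P}^1$, $Q_1,Q_2\in\mathbb{P}^n$) with $P_1\neq P_2$ and $Q_1\neq Q_2$, then $P_1\times Q_2\in\mathbb{X}$ or $P_2\times Q_1\in\mathbb{X}$ (or both). *)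

theory Defs
  imports
    "HOL-Library.Poly_Mapping"
    "HOL-Library.Extended_Nat"
    "HOL-Computational_Algebra.Polynomial"
    "HOL-Algebra.QuotRing"
    "HOL-Decision_Procs.Algebra_Aux"
    "HOL-Analysis.Finite_Cartesian_Product"
begin

section \<open>Krull dimension and depth of commutative rings\<close>

text \<open>
  Both are suprema of natural numbers in \<^typ>\<open>enat\<close>; for the zero ring both suprema are over
  the empty set and hence equal 0.
\<close>

definition prime_chain :: "('r, 'm) ring_scheme \<Rightarrow> nat \<Rightarrow> (nat \<Rightarrow> 'r set) \<Rightarrow> bool" where
  "prime_chain S d p \<longleftrightarrow>
     (\<forall>i\<le>d. primeideal (p i) S) \<and> (\<forall>i<d. p i \<subset> p (Suc i))"

definition krull_dim :: "('r, 'm) ring_scheme \<Rightarrow> enat" where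
  "krull_dim S = Sup {enat d | d. \<exists>p. prime_chain S d p}"

text \<open>
  \<open>f\<^sub>1, \<dots>, f\<^sub>r\<close> is regular on \<open>S\<close> if each \<open>f\<^sub>i\<close> is a nonzerodivisor
  on \<open>S/(f\<^sub>1, \<dots>, f\<^sub>i\<^sub>-\<^sub>1)\<close> and \<open>(f\<^sub>1, \<dots>, f\<^sub>r) \<noteq> S\<close>.
\<close>

definition regular_sequence :: "('r, 'm) ring_scheme \<Rightarrow> 'r list \<Rightarrow> bool" where
  "regular_sequence S fs \<longleftrightarrow>
     set fs \<subseteq> carrier S \<and>
     (\<forall>i<length fs. \<forall>a\<in>carrier S.
        fs ! i \<otimes>\<^bsub>S\<^esub> a \<in> genideal S (set (take i fs)) \<longrightarrow> a \<in> genideal S (set (take i fs))) \<and>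
     genideal S (set fs) \<noteq> carrier S"

definition depth_wrt :: "('r, 'm) ring_scheme \<Rightarrow> 'r set \<Rightarrow> enat" where
  "depth_wrt S J = Sup {enat (length fs) | fs. regular_sequence S fs \<and> set fs \<subseteq> J}"


section \<open>Projective space\<close>

text \<open>
  Projective space with homogeneous coordinates indexed by \<open>'i\<close>, of dimension
  \<open>CARD('i) - 1\<close>: nonzero vectors up to nonzero scalars.
\<close>

definition proj_eq :: "'k::field ^ 'i \<Rightarrow> 'k ^ 'i \<Rightarrow> bool" where
  "proj_eq u v \<longleftrightarrow> u \<noteq> 0 \<and> v \<noteq> 0 \<and> (\<exists>c. c \<noteq> 0 \<and> v = c *s u)"

lemma part_equivp_proj_eq: "part_equivp (proj_eq :: 'k::field ^ 'i \<Rightarrow> _)"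
proof (rule part_equivpI)
  have "(vec 1 :: 'k ^ 'i) \<noteq> 0"
    by (simp add: vec_eq_iff)
  then show "\<exists>u :: 'k ^ 'i. proj_eq u u"
    unfolding proj_eq_def by (metis vector_smult_lid zero_neq_one)
  show "symp (proj_eq :: 'k ^ 'i \<Rightarrow> _)"
  proof (rule sympI)
    fix u v :: "'k ^ 'i"
    assume "proj_eq u v"
    then obtain c where c: "u \<noteq> 0" "v \<noteq> 0" "c \<noteq> 0" "v = c *s u"
      by (auto simp: proj_eq_def)
    then have "u = inverse c *s v" "inverse c \<noteq> 0"
      by (simp_all add: vector_smult_assoc)
    with c show "proj_eq v u"
      unfolding proj_eq_def by blast
  qed
  show "transp (proj_eq :: 'k ^ 'i \<Rightarrow> _)"
  proof (rule transpI)
    fix u v w :: "'k ^ 'i"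
    assume "proj_eq u v" "proj_eq v w"
    then obtain c d where c: "u \<noteq> 0" "w \<noteq> 0" "c \<noteq> 0" "d \<noteq> 0" "w = d *s (c *s u)"
      by (auto simp: proj_eq_def)
    then have "w = (d * c) *s u" "d * c \<noteq> 0"
      by (simp_all add: vector_smult_assoc)
    with c show "proj_eq u w"
      unfolding proj_eq_def by blast
  qed
qed

quotient_type (overloaded) ('k, 'i) proj = "'k::field ^ 'i::finite" / partial: proj_eq
  by (rule part_equivp_proj_eq)

definition represents :: "'k::field ^ 'i \<Rightarrow> ('k, 'i) proj \<Rightarrow> bool" where
  "represents u P \<longleftrightarrow> u \<noteq> 0 \<and> abs_proj u = P"

type_synonym ('k, 'n) bipoint = "('k, 2) proj \<times> ('k, 'n) proj"


section \<open>The bigraded coordinate ring\<close>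

text \<open>
  Exponent vectors are finitely supported functions on the disjoint union \<open>2 + 'n\<close> of the
  index sets of the two groups of variables, so the type \<open>('k, 'n) bipoly\<close>, with its
  convolution product, is the whole polynomial ring \<open>k[x\<^sub>0, x\<^sub>1, y\<^sub>0, \<dots>, y\<^sub>n]\<close>
  when \<open>CARD('n) = n + 1\<close>.
\<close>

type_synonym 'n bimonom = "(2 + 'n) \<Rightarrow>\<^sub>0 nat"
type_synonym ('k, 'n) bipoly = "'n bimonom \<Rightarrow>\<^sub>0 'k"

abbreviation coord_ring :: "('k::comm_ring_1, 'n) bipoly ring" where
  "coord_ring \<equiv> cring_class_ops"

definition variable :: "2 + 'n \<Rightarrow> ('k::comm_ring_1, 'n) bipoly" where
  "variable i = Poly_Mapping.single (Poly_Mapping.single i 1) 1"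

definition irrelevant_ideal :: "('k::comm_ring_1, 'n) bipoly set" where
  "irrelevant_ideal = genideal coord_ring (range variable)"

definition bidegree :: "'n::finite bimonom \<Rightarrow> nat \<times> nat" where
  "bidegree m =
     (\<Sum>i\<in>UNIV. Poly_Mapping.lookup m (Inl i), \<Sum>j\<in>UNIV. Poly_Mapping.lookup m (Inr j))"

definition bihomogeneous :: "('k::comm_ring_1, 'n::finite) bipoly \<Rightarrow> bool" where
  "bihomogeneous f \<longleftrightarrow> (\<exists>d. \<forall>m\<in>Poly_Mapping.keys f. bidegree m = d)"

definition eval_bipoly :: "('k::comm_ring_1, 'n::finite) bipoly \<Rightarrow> 'k ^ 2 \<Rightarrow> 'k ^ 'n \<Rightarrow> 'k" where
  "eval_bipoly f u v =
     (\<Sum>m\<in>Poly_Mapping.keys f. Poly_Mapping.lookup f m *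
        (\<Prod>i\<in>UNIV. (u $ i) ^ Poly_Mapping.lookup m (Inl i)) *
        (\<Prod>j\<in>UNIV. (v $ j) ^ Poly_Mapping.lookup m (Inr j)))"

definition vanishes_at :: "('k::field, 'n::finite) bipoly \<Rightarrow> ('k, 'n) bipoint \<Rightarrow> bool" where
  "vanishes_at f pt \<longleftrightarrow>
     (\<forall>u v. represents u (fst pt) \<and> represents v (snd pt) \<longrightarrow> eval_bipoly f u v = 0)"

definition vanishing_ideal :: "('k::field, 'n::finite) bipoint set \<Rightarrow> ('k, 'n) bipoly set" where
  "vanishing_ideal X = genideal coord_ring {f. bihomogeneous f \<and> (\<forall>pt\<in>X. vanishes_at f pt)}"


section \<open>Arithmetically Cohen-Macaulay sets of points and property \<open>(\<star>)\<close>\<close>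

text \<open>
  The depth of \<open>R/I\<close> as an \<open>R\<close>-module with respect to the irrelevant ideal is computed in the
  ring \<open>R/I\<close>, with respect to the image of that ideal.
\<close>

definition arithmetically_CM :: "('k::field, 'n::finite) bipoint set \<Rightarrow> bool" where
  "arithmetically_CM X \<longleftrightarrow>
     (let I = vanishing_ideal X;
          A = coord_ring Quot I
      in krull_dim A = 2 \<and>
         depth_wrt A ((\<lambda>f. I +>\<^bsub>coord_ring\<^esub> f) ` irrelevant_ideal) = 2)"

definition property_star :: "('k::field, 'n::finite) bipoint set \<Rightarrow> bool" where
  "property_star X \<longleftrightarrow>
     (\<forall>P1 Q1 P2 Q2. (P1, Q1) \<in> X \<and> (P2, Q2) \<in> X \<and> P1 \<noteq> P2 \<and> Q1 \<noteq> Q2 \<longrightarrow>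
        (P1, Q2) \<in> X \<or> (P2, Q1) \<in> X)"

end

theory Submission
  imports Defs "HOL-Analysis.Cartesian_Space"
begin

text \<open>
  Write \<open>I\<close> for the ideal of \<open>X\<close>. Three facts about \<open>R/I\<close> give the theorem: both its dimension and
  its depth are at most 2, its dimension is at least 2, and there is a regular sequence of length 2,
  whose existence rests on property \<open>(\<star>)\<close>.

  A polynomial belongs to \<open>I\<close> iff it vanishes at every representative of every point
  (\<open>vanishing_ideal_eq\<close>), that is, iff for each point it is killed by the map
  \<open>x\<^sub>i \<mapsto> u\<^sub>i s\<close>, \<open>y\<^sub>j \<mapsto> v\<^sub>j t\<close> to \<open>k[s, t]\<close>, where \<open>(u, v)\<close> represents the point.

  Upper bounds. Counting monomials against the coefficients of their images in the rings \<open>k[s, t]\<close>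
  shows that any three elements of \<open>R/I\<close> are algebraically dependent over \<open>k\<close>
  (\<open>algebraic_relation\<close>). Suppose that \<open>K\<^sub>0 \<subseteq> K\<^sub>1 \<subseteq> K\<^sub>2 \<subseteq> K\<^sub>3\<close> are ideals and that \<open>a\<^sub>i \<in> K\<^sub>i\<^sub>+\<^sub>1\<close> is
  a nonzerodivisor modulo \<open>K\<^sub>i\<close>. The lexicographically lowest term of a relation between
  \<open>a\<^sub>0, a\<^sub>1, a\<^sub>2\<close> can be divided by these one after the other, which leaves a nonzero constant
  in \<open>K\<^sub>3\<close> (\<open>relation_collapses_filtration\<close>). Both a chain of four primes and a regular sequence of
  length three would give such a filtration with \<open>K\<^sub>3\<close> a proper ideal.

  Dimension at least 2. For one point, the kernels of \<open>R \<rightarrow> k[s, t] \<rightarrow> k[s] \<rightarrow> k\<close> are three primes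
  that contain \<open>I\<close>.

  Depth at least 2. The first element is a linear form \<open>\<ell> = x\<^sub>1 - c x\<^sub>2\<close> that vanishes at no point of
  the projection of \<open>X\<close> to the projective line; the second is a linear form \<open>m\<close> in the \<open>y\<^sub>j\<close> that
  vanishes at no point of the projection to the other factor. The point is to describe \<open>I + (\<ell>)\<close>.
  For a point \<open>Q\<close> with representative \<open>v\<close> let \<open>r\<^sub>Q\<close> be the number of points of \<open>X\<close> above \<open>Q\<close>.
  Then \<open>I + (\<ell>)\<close> consists of the \<open>f\<close> for which \<open>f(c z, z, v)\<close> is divisible by \<open>z\<close> to the power
  \<open>r\<^sub>Q\<close>, for every \<open>Q\<close>. This condition does not change when \<open>f\<close> is multiplied by \<open>m\<close>, because
  \<open>m\<close> takes a nonzero constant value there; so \<open>m\<close> is a nonzerodivisor modulo \<open>I + (\<ell>)\<close>.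

  Elements of \<open>I\<close> satisfy the condition because a binary form of degree less than \<open>r\<^sub>Q\<close> with \<open>r\<^sub>Q\<close>
  zeros on the line is zero (\<open>vanishing_ideal_subset_fibre_order_ideal\<close>). For the converse, property
  \<open>(\<star>)\<close> says that the fibres of \<open>X\<close> over the points \<open>Q\<close> form a chain
  (\<open>fibre_chain\<close>). Hence the union \<open>S\<close> of all fibres with at most \<open>d\<close> points has itself at
  most \<open>d\<close> points. Modulo \<open>\<ell>\<close>, the power of \<open>x\<^sub>2\<close> with exponent \<open>d\<close> is congruent to a form that
  vanishes on \<open>S\<close>, and the part of \<open>f\<close> of degree \<open>d\<close> in \<open>x\<^sub>2\<close> vanishes at all \<open>Q\<close> with larger
  fibres, so their product lies in \<open>I\<close> (\<open>fibre_order_ideal_subset\<close>).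
\<close>

section \<open>Ideals of a commutative ring and of its quotients\<close>

lemma ideal_classI:
  fixes K :: "'a::comm_ring_1 set"
  assumes "0 \<in> K" "\<And>a b. a \<in> K \<Longrightarrow> b \<in> K \<Longrightarrow> a + b \<in> K" "\<And>r a. a \<in> K \<Longrightarrow> r * a \<in> K"
  shows "ideal K cring_class_ops"
proof (rule idealI[OF cring_class.ring_axioms])
  have neg: "- a \<in> K" if "a \<in> K" for a
    using assms(3)[of a "-1"] that by simp
  show "subgroup K (add_monoid cring_class_ops)"
  proof (rule group.subgroupI)
    show "Group.group (add_monoid (cring_class_ops :: 'a ring))"
      by (rule abelian_group.a_group[OF ring.is_abelian_group[OF cring_class.ring_axioms]])
    show "inv\<^bsub>add_monoid cring_class_ops\<^esub> a \<in> K" if "a \<in> K" for a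
      using neg[OF that] uminus_class[of a] by (simp add: a_inv_def)
  qed (use assms in \<open>auto simp: cring_class_ops_def\<close>)
qed (use assms in \<open>auto simp: cring_class_ops_def mult.commute\<close>)

lemma ideal_class_zero: "ideal K cring_class_ops \<Longrightarrow> (0::'a::comm_ring_1) \<in> K"
  using additive_subgroup.zero_closed[of K cring_class_ops]
  by (simp add: ideal_def zero_class)

lemma ideal_class_add:
  "ideal K cring_class_ops \<Longrightarrow> a \<in> K \<Longrightarrow> b \<in> K \<Longrightarrow> a + (b::'a::comm_ring_1) \<in> K"
  using additive_subgroup.a_closed[of K cring_class_ops a b]
  by (simp add: ideal_def plus_class)

lemma ideal_class_mult:
  "ideal K cring_class_ops \<Longrightarrow> a \<in> K \<Longrightarrow> r * (a::'a::comm_ring_1) \<in> K"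
  using ideal.I_l_closed[of K cring_class_ops a r]
  by (simp add: times_class carrier_class)

lemma ideal_class_diff:
  "ideal K cring_class_ops \<Longrightarrow> a \<in> K \<Longrightarrow> b \<in> K \<Longrightarrow> a - (b::'a::comm_ring_1) \<in> K"
  using ideal_class_add[of K a "(-1) * b"] ideal_class_mult[of K b "-1"] by simp

lemma ideal_class_sum:
  "ideal K cring_class_ops \<Longrightarrow> (\<And>i. i \<in> S \<Longrightarrow> g i \<in> K) \<Longrightarrow> (\<Sum>i\<in>S. g i) \<in> (K :: 'a::comm_ring_1 set)"
  by (induction S rule: infinite_finite_induct) (auto simp: ideal_class_zero ideal_class_add)

text \<open>
  A type-class ring modulo an ideal, with the means to move ideals between the ring and the quotient:
  images and preimages under the projection are mutually inverse on the ideals that contain \<open>I\<close>, so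
  all ideal arithmetic below takes place in the ring itself.
\<close>

locale class_quotient =
  fixes I :: "'a::comm_ring_1 set"
  assumes ideal_I: "ideal I cring_class_ops"
begin

abbreviation Q :: "'a set ring" where "Q \<equiv> cring_class_ops Quot I"

definition proj_Q :: "'a \<Rightarrow> 'a set" where "proj_Q f = I +>\<^bsub>cring_class_ops\<^esub> f"

sublocale proj: ring_hom_cring cring_class_ops Q proj_Q
  using ideal.rcos_ring_hom_cring[OF ideal_I cring_class] by (simp add: proj_Q_def[abs_def])

lemma proj_mult: "proj_Q (a * b) = proj_Q a \<otimes>\<^bsub>Q\<^esub> proj_Q b"
  using proj.hom_mult[of a b] by (simp add: carrier_class times_class)

lemma carrier_Q: "carrier Q = range proj_Q"
  by (auto simp: FactRing_def A_RCOSETS_def' proj_Q_def carrier_class)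

lemma proj_eq_iff: "proj_Q a = proj_Q b \<longleftrightarrow> a - b \<in> I"
proof -
  have *: "proj_Q x = {h + x |h. h \<in> I}" for x
    by (auto simp: proj_Q_def a_r_coset_def' plus_class)
  show ?thesis
  proof
    assume "proj_Q a = proj_Q b"
    moreover have "a \<in> proj_Q a"
      using ideal_class_zero[OF ideal_I] unfolding * by force
    ultimately show "a - b \<in> I"
      unfolding * by auto
  next
    assume d: "a - b \<in> I"
    have "h + a = (h + (a - b)) + b" "h + b = (h - (a - b)) + a" for h
      by simp_all
    with d show "proj_Q a = proj_Q b"
      unfolding * using ideal_class_add[OF ideal_I _ d] ideal_class_diff[OF ideal_I _ d]
      by (auto; metis)
  qed
qed

lemma ideal_vimage: "ideal K Q \<Longrightarrow> ideal (proj_Q -` K) cring_class_ops"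
  using ring_hom_ring.ideal_vimage[OF ideal.rcos_ring_hom_ring[OF ideal_I], of K]
  by (simp add: carrier_class vimage_def proj_Q_def)

lemma proj_image_iff:
  assumes "ideal K cring_class_ops" "I \<subseteq> K"
  shows "proj_Q a \<in> proj_Q ` K \<longleftrightarrow> a \<in> K"
proof
  assume "proj_Q a \<in> proj_Q ` K"
  then obtain b where "b \<in> K" "a - b \<in> I" by (auto simp: proj_eq_iff)
  then show "a \<in> K" using ideal_class_add[OF assms(1), of "a - b" b] assms(2) by auto
qed auto

lemma ideal_image:
  assumes K: "ideal K cring_class_ops"
  shows "ideal (proj_Q ` K) Q"
  using ring.ring_ideal_imp_quot_ideal[OF cring_class.ring_axioms ideal_I K]
  by (simp add: proj_Q_def[abs_def])

lemma primeideal_image: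
  assumes K: "ideal K cring_class_ops" and "I \<subseteq> K" and "1 \<notin> K"
    and prime: "\<And>a b. a * b \<in> K \<Longrightarrow> a \<in> K \<or> b \<in> K"
  shows "primeideal (proj_Q ` K) Q"
proof (rule primeidealI[OF ideal_image[OF K] proj.S.is_cring])
  show "carrier Q \<noteq> proj_Q ` K"
    using proj_image_iff[OF K assms(2), of 1] \<open>1 \<notin> K\<close> by (auto simp: carrier_Q)
  show "a \<in> proj_Q ` K \<or> b \<in> proj_Q ` K"
    if ab: "a \<in> carrier Q" "b \<in> carrier Q" "a \<otimes>\<^bsub>Q\<^esub> b \<in> proj_Q ` K" for a b
  proof -
    obtain x y where xy: "a = proj_Q x" "b = proj_Q y"
      using ab(1,2) by (auto simp: carrier_Q)
    with ab(3) have "x * y \<in> K"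
      using proj_image_iff[OF K assms(2)] by (simp only: proj_mult[symmetric])
    then show ?thesis
      using prime xy by auto
  qed
qed

end

section \<open>Evaluation of polynomials\<close>

text \<open>
  Evaluation of polynomials is needed with values in the field, in polynomial rings over it, and in
  the coordinate ring itself. All these maps are instances of one insertion homomorphism.
\<close>

locale unital_hom =
  fixes h :: "'a::comm_ring_1 \<Rightarrow> 'b::comm_ring_1"
  assumes hom_1: "h 1 = 1" and hom_add: "h (a + b) = h a + h b" and hom_mult: "h (a * b) = h a * h b"
begin

lemma hom_0: "h 0 = 0"
  using hom_add[of 0 0] by simp

lemma hom_uminus: "h (- a) = - h a"
  using hom_add[of a "- a"] by (simp add: hom_0 eq_neg_iff_add_eq_0 add.commute)

lemma hom_diff: "h (a - b) = h a - h b"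
  using hom_add[of a "- b"] by (simp add: hom_uminus)

lemma hom_sum: "h (\<Sum>i\<in>S. g i) = (\<Sum>i\<in>S. h (g i))"
  by (induction S rule: infinite_finite_induct) (auto simp: hom_0 hom_add)

lemma hom_prod: "h (\<Prod>i\<in>S. g i) = (\<Prod>i\<in>S. h (g i))"
  by (induction S rule: infinite_finite_induct) (auto simp: hom_1 hom_mult)

lemma hom_power: "h (a ^ n) = h a ^ n"
  by (induction n) (auto simp: hom_1 hom_mult)

lemma ideal_kernel: "ideal {f. h f = 0} cring_class_ops"
  by (rule ideal_classI) (auto simp: hom_0 hom_add hom_mult)

lemma unital_hom_map_poly: "unital_hom (map_poly h)"
  by standard
    (auto simp: poly_eq_iff coeff_map_poly hom_0 hom_add hom_mult hom_1 coeff_mult hom_sum)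

lemma poly_map_poly: "poly (map_poly h p) (h x) = h (poly p x)"
proof -
  have "degree (map_poly h p) \<le> degree p"
    by (rule degree_le) (auto simp: coeff_map_poly hom_0 coeff_eq_0)
  then have "poly (map_poly h p) (h x) = (\<Sum>i\<le>degree p. coeff (map_poly h p) i * h x ^ i)"
    by (subst poly_altdef, intro sum.mono_neutral_left) (auto simp: coeff_eq_0)
  then show ?thesis
    by (simp add: poly_altdef hom_sum hom_mult hom_power coeff_map_poly hom_0)
qed

end

lemma unital_hom_ident: "unital_hom (\<lambda>x. x)"
  by standard auto

lemma unital_hom_comp: "unital_hom g \<Longrightarrow> unital_hom h \<Longrightarrow> unital_hom (\<lambda>x. g (h x))"
  by (simp add: unital_hom_def)

lemma unital_hom_poly: "unital_hom (\<lambda>p. poly p x)"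
  by standard auto

lemma unital_hom_const_poly: "unital_hom (\<lambda>c. [:c:])"
  by standard (auto simp: one_pCons)

definition const :: "'k::comm_ring_1 \<Rightarrow> ('i \<Rightarrow>\<^sub>0 nat) \<Rightarrow>\<^sub>0 'k" where
  "const c = Poly_Mapping.single 0 c"

lemma unital_hom_const: "unital_hom const"
  by standard (auto simp: const_def single_add mult_single)

definition insertion_hom ::
    "('k::comm_ring_1 \<Rightarrow> 'b::comm_ring_1) \<Rightarrow> ('i::finite \<Rightarrow> 'b) \<Rightarrow> (('i \<Rightarrow>\<^sub>0 nat) \<Rightarrow>\<^sub>0 'k) \<Rightarrow> 'b" where
  "insertion_hom h a f =
     (\<Sum>m\<in>Poly_Mapping.keys f. h (Poly_Mapping.lookup f m) * (\<Prod>i\<in>UNIV. a i ^ Poly_Mapping.lookup m i))"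

lemma sum_monomials: "f = (\<Sum>m\<in>Poly_Mapping.keys f. Poly_Mapping.single m (Poly_Mapping.lookup f m))"
proof (rule poly_mapping_eqI)
  fix k
  have "(\<Sum>m\<in>Poly_Mapping.keys f. Poly_Mapping.lookup (Poly_Mapping.single m (Poly_Mapping.lookup f m)) k)
      = (\<Sum>m\<in>Poly_Mapping.keys f. if m = k then Poly_Mapping.lookup f k else 0)"
    by (rule sum.cong) (auto simp: lookup_single)
  then show "Poly_Mapping.lookup f k = Poly_Mapping.lookup
      (\<Sum>m\<in>Poly_Mapping.keys f. Poly_Mapping.single m (Poly_Mapping.lookup f m)) k"
    by (simp add: lookup_sum sum.delta in_keys_iff)
qed

context
  fixes h :: "'k::comm_ring_1 \<Rightarrow> 'b::comm_ring_1" and a :: "'i::finite \<Rightarrow> 'b"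
  assumes h: "unital_hom h"
begin

interpretation unital_hom h by (rule h)

lemma insertion_hom_superset:
  assumes "finite S" "Poly_Mapping.keys f \<subseteq> S"
  shows "insertion_hom h a f =
    (\<Sum>m\<in>S. h (Poly_Mapping.lookup f m) * (\<Prod>i\<in>UNIV. a i ^ Poly_Mapping.lookup m i))"
  unfolding insertion_hom_def
  by (rule sum.mono_neutral_left) (use assms in \<open>auto simp: in_keys_iff hom_0\<close>)

lemma insertion_hom_single:
  "insertion_hom h a (Poly_Mapping.single m c) = h c * (\<Prod>i\<in>UNIV. a i ^ Poly_Mapping.lookup m i)"
  by (subst insertion_hom_superset[of "{m}"]) auto

lemma insertion_hom_const: "insertion_hom h a (const c) = h c"
  by (simp add: const_def insertion_hom_single)

lemma insertion_hom_add: "insertion_hom h a (f + g) = insertion_hom h a f + insertion_hom h a g"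
proof -
  let ?S = "Poly_Mapping.keys f \<union> Poly_Mapping.keys g"
  have "Poly_Mapping.keys (f + g) \<subseteq> ?S" by (rule Poly_Mapping.keys_add)
  then show ?thesis
    by (simp add: insertion_hom_superset[of ?S] lookup_add hom_add distrib_right sum.distrib)
qed

lemma insertion_hom_0: "insertion_hom h a 0 = 0"
  by (simp add: insertion_hom_def)

lemma insertion_hom_sum: "insertion_hom h a (\<Sum>i\<in>S. g i) = (\<Sum>i\<in>S. insertion_hom h a (g i))"
  by (induction S rule: infinite_finite_induct) (auto simp: insertion_hom_add insertion_hom_0)

lemma insertion_hom_mult: "insertion_hom h a (f * g) = insertion_hom h a f * insertion_hom h a g"
proof -
  let ?s = "\<lambda>f m. Poly_Mapping.single m (Poly_Mapping.lookup f m)"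
  have "insertion_hom h a (?s f m * ?s g m') = insertion_hom h a (?s f m) * insertion_hom h a (?s g m')" for m m'
    by (simp add: mult_single insertion_hom_single hom_mult lookup_add power_add prod.distrib mult_ac)
  then have "insertion_hom h a ((\<Sum>m\<in>Poly_Mapping.keys f. ?s f m) * (\<Sum>m\<in>Poly_Mapping.keys g. ?s g m))
     = insertion_hom h a (\<Sum>m\<in>Poly_Mapping.keys f. ?s f m) * insertion_hom h a (\<Sum>m\<in>Poly_Mapping.keys g. ?s g m)"
    by (simp add: sum_product insertion_hom_sum)
  then show ?thesis
    by (simp add: sum_monomials[symmetric])
qed

lemma unital_hom_insertion: "unital_hom (insertion_hom h a)"
proof
  show "insertion_hom h a 1 = 1"
    using insertion_hom_const[of 1] by (simp add: const_def hom_1)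
qed (auto simp: insertion_hom_add insertion_hom_mult)

end

lemma insertion_hom_variable:
  "unital_hom h \<Longrightarrow> insertion_hom h a (variable i) = (a i :: 'b::comm_ring_1)"
proof -
  assume h: "unital_hom h"
  have "(\<Prod>j\<in>UNIV. a j ^ Poly_Mapping.lookup (Poly_Mapping.single i 1) j) = (\<Prod>j\<in>UNIV. if j = i then a i else 1)"
    by (rule prod.cong) (auto simp: lookup_single when_def)
  then show ?thesis
    using h by (simp add: variable_def insertion_hom_single unital_hom.hom_1)
qed

lemma hom_insertion_hom:
  "unital_hom g \<Longrightarrow> g (insertion_hom h a f) = insertion_hom (\<lambda>c. g (h c)) (\<lambda>i. g (a i)) f"
  by (simp add: insertion_hom_def unital_hom.hom_sum unital_hom.hom_mult unital_hom.hom_prod unital_hom.hom_power)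

lemma insertion_hom_const_variable:
  "insertion_hom const variable f = (f :: ('a::comm_ring_1, 'b::finite) bipoly)"
proof -
  have power: "variable i ^ n = Poly_Mapping.single (Poly_Mapping.single i n) (1 :: 'a)" for i :: "2 + 'b" and n
    by (induction n) (auto simp: variable_def mult_single single_add[symmetric])
  have "(\<Prod>i\<in>S. variable i ^ l i) = Poly_Mapping.single (\<Sum>i\<in>S. Poly_Mapping.single i (l i)) (1 :: 'a)"
    for S :: "(2 + 'b) set" and l
    by (induction S rule: infinite_finite_induct) (auto simp: power mult_single)
  moreover have "(\<Sum>i\<in>UNIV. Poly_Mapping.single i (Poly_Mapping.lookup m i)) = m" for m :: "(2 + 'b) \<Rightarrow>\<^sub>0 nat"
    by (rule poly_mapping_eqI) (simp add: lookup_sum lookup_single when_def)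
  ultimately show ?thesis
    by (subst (2) sum_monomials) (simp add: insertion_hom_def const_def mult_single)
qed

lemma dvd_prod_diff:
  fixes d :: "'a::comm_ring_1"
  assumes "\<And>i. i \<in> S \<Longrightarrow> d dvd a i - b i"
  shows "d dvd (\<Prod>i\<in>S. a i) - (\<Prod>i\<in>S. b i)"
  using assms
proof (induction S rule: infinite_finite_induct)
  case (insert x S)
  have "(\<Prod>i\<in>insert x S. a i) - (\<Prod>i\<in>insert x S. b i) =
      a x * ((\<Prod>i\<in>S. a i) - (\<Prod>i\<in>S. b i)) + (a x - b x) * (\<Prod>i\<in>S. b i)"
    using insert by (simp add: algebra_simps)
  then show ?case using insert by simp
qed simp_all

text \<open>
  Substituting congruent values gives congruent results. This allows \<open>x\<^sub>1\<close> to be replaced by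
  \<open>c x\<^sub>2\<close> modulo \<open>\<ell>\<close>.
\<close>

lemma dvd_insertion_hom_diff:
  assumes "\<And>i. d dvd a i - b i"
  shows "d dvd insertion_hom h a f - insertion_hom h b f"
proof -
  have "d dvd a i ^ n - b i ^ n" for i n
    using assms[of i] by (metis dvd_mult2 power_diff_sumr2)
  then have pr: "d dvd (\<Prod>i\<in>UNIV. a i ^ l i) - (\<Prod>i\<in>UNIV. b i ^ l i)" for l
    by (intro dvd_prod_diff)
  show ?thesis
    unfolding insertion_hom_def sum_subtractf[symmetric]
    by (intro dvd_sum) (simp add: right_diff_distrib[symmetric] pr)
qed

section \<open>Three elements always satisfy a relation\<close>

text \<open>
  Gaussian elimination, by induction on the number of equations: solve one equation for an unknown
  with nonzero coefficient and substitute into the others.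
\<close>

lemma underdetermined_system:
  fixes A :: "'e \<Rightarrow> 'u \<Rightarrow> 'k::field"
  assumes "finite E" "finite U" "card E < card U"
  shows "\<exists>x. (\<exists>u\<in>U. x u \<noteq> 0) \<and> (\<forall>e\<in>E. (\<Sum>u\<in>U. A e u * x u) = 0)"
  using assms
proof (induction E arbitrary: A U rule: finite_induct)
  case empty
  then have "U \<noteq> {}" by auto
  then show ?case by (intro exI[of _ "\<lambda>_. 1"]) auto
next
  case (insert e E)
  show ?case
  proof (cases "\<forall>u\<in>U. A e u = 0")
    case True
    have "card E < card U" using insert by simp
    then obtain x where "\<exists>u\<in>U. x u \<noteq> 0" "\<forall>e\<in>E. (\<Sum>u\<in>U. A e u * x u) = 0"
      using insert.IH[of U A] insert.prems by auto
    with True show ?thesis by (intro exI[of _ x]) auto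
  next
    case False
    then obtain u0 where u0: "u0 \<in> U" "A e u0 \<noteq> 0" by auto
    define V where "V = U - {u0}"
    have V: "finite V" "card E < card V" "u0 \<notin> V" "U = insert u0 V"
      using insert u0 by (auto simp: V_def)
    obtain y where y: "\<exists>u\<in>V. y u \<noteq> 0"
        "\<forall>e'\<in>E. (\<Sum>u\<in>V. (A e' u - A e' u0 * A e u / A e u0) * y u) = 0"
      using insert.IH[OF V(1,2), of "\<lambda>e' u. A e' u - A e' u0 * A e u / A e u0"] by auto
    define s where "s = (\<Sum>u\<in>V. A e u * y u)"
    define x where "x = y(u0 := - s / A e u0)"
    have xV: "x u = y u" if "u \<in> V" for u
      using that V(3) by (auto simp: x_def)
    have split: "(\<Sum>u\<in>U. A e' u * x u) = A e' u0 * (- s / A e u0) + (\<Sum>u\<in>V. A e' u * y u)" for e'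
      using V by (simp add: xV) (simp add: x_def)
    have "(\<Sum>u\<in>U. A e' u * x u) = 0" if "e' \<in> E" for e'
    proof -
      have "(\<Sum>u\<in>V. (A e' u - A e' u0 * A e u / A e u0) * y u) =
        (\<Sum>u\<in>V. A e' u * y u) - A e' u0 / A e u0 * s"
        by (simp add: s_def sum_distrib_left sum_subtractf[symmetric] algebra_simps)
      with bspec[OF y(2) that] have "(\<Sum>u\<in>V. A e' u * y u) = A e' u0 / A e u0 * s"
        by (simp only: diff_eq_eq add_0 eq_commute[of 0])
      then show ?thesis
        by (simp add: split)
    qed
    moreover have "(\<Sum>u\<in>U. A e u * x u) = 0"
      using u0 by (simp add: split) (simp add: s_def)
    moreover have "\<exists>u\<in>U. x u \<noteq> 0"
      using y(1) xV V(4) by (metis insertI2)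
    ultimately show ?thesis by blast
  qed
qed

definition bidegree_le :: "nat \<Rightarrow> 'k::idom poly poly \<Rightarrow> bool" where
  "bidegree_le D p \<longleftrightarrow> degree p \<le> D \<and> (\<forall>i. degree (coeff p i) \<le> D)"

lemma bidegree_le_mono: "bidegree_le D p \<Longrightarrow> D \<le> E \<Longrightarrow> bidegree_le E p"
  unfolding bidegree_le_def by (meson le_trans)

lemma bidegree_le_exists: "\<exists>D. bidegree_le D p"
proof -
  let ?D = "degree p + (\<Sum>i\<le>degree p. degree (coeff p i))"
  have "degree (coeff p i) \<le> ?D" for i
  proof (cases "i \<le> degree p")
    case True
    then have "degree (coeff p i) \<le> (\<Sum>i\<le>degree p. degree (coeff p i))"
      by (intro member_le_sum) auto
    then show ?thesis by simp
  qed (simp add: coeff_eq_0)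
  then show ?thesis
    by (intro exI[of _ ?D]) (auto simp: bidegree_le_def)
qed

lemma bidegree_le_finite: "finite P \<Longrightarrow> \<exists>D. \<forall>p\<in>P. bidegree_le D p"
proof (induction P rule: finite_induct)
  case (insert p P)
  then obtain D E where "\<forall>p\<in>P. bidegree_le D p" "bidegree_le E p"
    using bidegree_le_exists by blast
  then show ?case
    by (intro exI[of _ "max D E"]) (auto intro: bidegree_le_mono)
qed auto

lemma bidegree_le_mult:
  assumes "bidegree_le D p" "bidegree_le E q"
  shows "bidegree_le (D + E) (p * q)"
proof -
  have "degree (coeff p i * coeff q j) \<le> D + E" for i j
    using assms degree_mult_le[of "coeff p i" "coeff q j"] unfolding bidegree_le_def
    by (meson add_mono le_trans)
  then have "degree (coeff (p * q) n) \<le> D + E" for n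
    unfolding coeff_mult by (intro degree_sum_le) auto
  moreover have "degree (p * q) \<le> D + E"
    using assms degree_mult_le[of p q] unfolding bidegree_le_def by linarith
  ultimately show ?thesis by (simp add: bidegree_le_def)
qed

lemma bidegree_le_power: "bidegree_le D p \<Longrightarrow> bidegree_le (n * D) (p ^ n)"
  by (induction n) (auto intro: bidegree_le_mult, simp add: bidegree_le_def)

text \<open>
  The monomials in \<open>f, g, h\<close> with all exponents at most \<open>N\<close> are \<open>(N + 1)\<^sup>3\<close> in number, whereas the
  coefficients of their images under the maps \<open>\<theta> p\<close> number only a constant times \<open>N\<^sup>2\<close>. For large
  \<open>N\<close> a nontrivial combination of the monomials is therefore killed by all these maps.
\<close>

lemma algebraic_relation:
  fixes \<theta> :: "'p \<Rightarrow> 'r::comm_ring_1 \<Rightarrow> 'k::field poly poly" and \<iota> :: "'k \<Rightarrow> 'r"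
  assumes "finite X" and hom: "\<And>p. p \<in> X \<Longrightarrow> unital_hom (\<theta> p)"
    and const: "\<And>p c. p \<in> X \<Longrightarrow> \<theta> p (\<iota> c) = [:[:c:]:]"
  shows "\<exists>N c. (\<exists>i\<le>N. \<exists>j\<le>N. \<exists>l\<le>N. c i j l \<noteq> 0) \<and>
    (\<forall>p\<in>X. \<theta> p (\<Sum>i\<le>N. (\<Sum>j\<le>N. (\<Sum>l\<le>N. \<iota> (c i j l) * h ^ l) * g ^ j) * f ^ i) = 0)"
proof -
  have "finite ((\<lambda>p. \<theta> p f) ` X \<union> (\<lambda>p. \<theta> p g) ` X \<union> (\<lambda>p. \<theta> p h) ` X)"
    using assms(1) by simp
  from bidegree_le_finite[OF this] obtain D0 where
    "\<forall>q \<in> (\<lambda>p. \<theta> p f) ` X \<union> (\<lambda>p. \<theta> p g) ` X \<union> (\<lambda>p. \<theta> p h) ` X. bidegree_le D0 q" by blast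
  then have D0: "bidegree_le D0 (\<theta> p f)" "bidegree_le D0 (\<theta> p g)" "bidegree_le D0 (\<theta> p h)" if "p \<in> X" for p
    using that by auto
  define D where "D = Suc D0"
  have D: "bidegree_le D (\<theta> p f)" "bidegree_le D (\<theta> p g)" "bidegree_le D (\<theta> p h)" if "p \<in> X" for p
    using D0[OF that] by (auto simp: D_def intro: bidegree_le_mono)
  \<comment> \<open>Chosen so that \<open>card X * (3 N D + 1)\<^sup>2 \<le> 9 D\<^sup>2 card X (N + 1)\<^sup>2 = N (N + 1)\<^sup>2 < (N + 1)\<^sup>3\<close>.\<close>
  define N where "N = 9 * D\<^sup>2 * card X"
  define M where "M = 3 * N * D"
  define U where "U = {..N} \<times> {..N} \<times> {..N}"
  define E where "E = X \<times> {..M} \<times> {..M}"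
  have "card E < card U"
  proof -
    have "M + 1 \<le> 3 * D * (N + 1)" by (simp add: M_def D_def algebra_simps)
    then have "(M + 1)\<^sup>2 \<le> (3 * D * (N + 1))\<^sup>2" by (rule power_mono) simp
    then have "card X * (M + 1)\<^sup>2 \<le> card X * (3 * D * (N + 1))\<^sup>2" by (rule mult_left_mono) simp
    also have "\<dots> = N * (N + 1)\<^sup>2" by (simp add: N_def power2_eq_square algebra_simps)
    also have "\<dots> < (N + 1) * (N + 1)\<^sup>2" by (rule mult_strict_right_mono) auto
    finally show ?thesis
      by (simp add: U_def E_def card_cartesian_product power2_eq_square)
  qed
  moreover have "finite E" "finite U" using assms(1) by (auto simp: E_def U_def)
  moreover define mon where "mon = (\<lambda>(i, j, l). h ^ l * g ^ j * f ^ i)"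
  moreover define A where "A = (\<lambda>e u. coeff (coeff (\<theta> (fst e) (mon u)) (fst (snd e))) (snd (snd e)))"
  ultimately obtain x where x1: "\<exists>u\<in>U. x u \<noteq> 0" and xA: "\<forall>e\<in>E. (\<Sum>u\<in>U. A e u * x u) = 0"
    using underdetermined_system[of E U A] by blast
  have x: "(\<Sum>u\<in>U. coeff (coeff (\<theta> p (mon u)) a) b * x u) = 0" if "(p, a, b) \<in> E" for p a b
    using bspec[OF xA that] by (simp add: A_def)
  have "\<theta> p (\<Sum>i\<le>N. (\<Sum>j\<le>N. (\<Sum>l\<le>N. \<iota> (x (i, j, l)) * h ^ l) * g ^ j) * f ^ i) = 0" if p: "p \<in> X" for p
  proof -
    interpret unital_hom "\<theta> p" using hom p .
    have bd: "bidegree_le M (\<theta> p (mon u))" if u: "u \<in> U" for u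
    proof -
      obtain i j l where ijl: "u = (i, j, l)" "i \<le> N" "j \<le> N" "l \<le> N" using u by (auto simp: U_def)
      have "bidegree_le (l * D + j * D + i * D) (\<theta> p h ^ l * \<theta> p g ^ j * \<theta> p f ^ i)"
        by (intro bidegree_le_mult bidegree_le_power D p)
      moreover have "l * D + j * D + i * D \<le> M"
        using ijl mult_right_mono[of "l + j + i" "3 * N" D] by (simp add: M_def distrib_right)
      ultimately show ?thesis
        by (simp add: ijl(1) mon_def hom_mult hom_power bidegree_le_mono)
    qed
    have "(\<Sum>i\<le>N. (\<Sum>j\<le>N. (\<Sum>l\<le>N. \<iota> (x (i, j, l)) * h ^ l) * g ^ j) * f ^ i) = (\<Sum>u\<in>U. \<iota> (x u) * mon u)"
      by (simp add: U_def mon_def sum.cartesian_product' sum_distrib_right sum_distrib_left mult_ac)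
    then have "\<theta> p (\<Sum>i\<le>N. (\<Sum>j\<le>N. (\<Sum>l\<le>N. \<iota> (x (i, j, l)) * h ^ l) * g ^ j) * f ^ i)
      = (\<Sum>u\<in>U. [:[:x u:]:] * \<theta> p (mon u))"
      using p by (simp add: hom_sum hom_mult const)
    also have "coeff (coeff \<dots> a) b = 0" for a b
    proof (cases "a \<le> M \<and> b \<le> M")
      case True
      then show ?thesis
        using x[of p a b] p by (simp add: E_def coeff_sum mult.commute)
    next
      case False
      then have "coeff (coeff (\<theta> p (mon u)) a) b = 0" if "u \<in> U" for u
        using bd[OF that] unfolding bidegree_le_def
        by (metis coeff_0 coeff_eq_0 le_trans not_le)
      then show ?thesis by (simp add: coeff_sum)
    qed
    ultimately show ?thesis by (simp add: poly_eq_iff)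
  qed
  moreover have "\<exists>i\<le>N. \<exists>j\<le>N. \<exists>l\<le>N. x (i, j, l) \<noteq> 0" using x1 by (auto simp: U_def)
  ultimately show ?thesis
    by (intro exI[of _ N] exI[of _ "\<lambda>i j l. x (i, j, l)"]) blast
qed

text \<open>
  If the relation starts at \<open>x ^ m\<close>, this power can be cancelled modulo \<open>K\<close>; all terms but the first
  are then still multiples of \<open>x\<close>, hence in \<open>K'\<close>.
\<close>

lemma lowest_coeff_mem:
  fixes K K' :: "'a::comm_ring_1 set"
  assumes K: "ideal K cring_class_ops" "ideal K' cring_class_ops" "K \<subseteq> K'"
    and x: "x \<in> K'" "\<And>y. x * y \<in> K \<Longrightarrow> y \<in> K"
    and rel: "(\<Sum>i\<le>N. g i * x ^ i) \<in> K" and m: "m \<le> N" "\<And>i. i < m \<Longrightarrow> g i = 0"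
  shows "g m \<in> K'"
proof -
  have "(\<Sum>i\<le>N. g i * x ^ i) = (\<Sum>i=m..N. g i * x ^ i)"
    by (rule sum.mono_neutral_right) (auto simp: m)
  also have "\<dots> = x ^ m * (\<Sum>i=m..N. g i * x ^ (i - m))"
    unfolding sum_distrib_left by (rule sum.cong) (auto simp: power_add[symmetric] mult_ac)
  finally have "x ^ m * (\<Sum>i=m..N. g i * x ^ (i - m)) \<in> K" using rel by simp
  moreover have "y \<in> K" if "x ^ n * y \<in> K" for n y
    using that by (induction n) (auto simp: mult.assoc dest: x(2))
  ultimately have "(\<Sum>i=m..N. g i * x ^ (i - m)) \<in> K'" using K(3) by blast
  also have "(\<Sum>i=m..N. g i * x ^ (i - m)) = g m + (\<Sum>i=Suc m..N. g i * x ^ (i - m))"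
    using m(1) by (simp add: sum.atLeast_Suc_atMost)
  finally have "g m + (\<Sum>i=Suc m..N. g i * x ^ (i - m)) \<in> K'" .
  moreover have "g i * x ^ (i - m) \<in> K'" if "i \<in> {Suc m..N}" for i
  proof -
    have "g i * x ^ (i - m) = (g i * x ^ (i - m - 1)) * x"
      using that by (cases "i - m") auto
    then show ?thesis using ideal_class_mult[OF K(2) x(1)] by simp
  qed
  then have "(\<Sum>i=Suc m..N. g i * x ^ (i - m)) \<in> K'" by (rule ideal_class_sum[OF K(2)])
  ultimately have "g m + (\<Sum>i=Suc m..N. g i * x ^ (i - m)) - (\<Sum>i=Suc m..N. g i * x ^ (i - m)) \<in> K'"
    by (rule ideal_class_diff[OF K(2)])
  then show ?thesis by simp
qed

text \<open>
  The previous lemma is applied to the three variables in turn, always at the lowest occurring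
  exponent. What remains in \<open>K 3\<close> is the coefficient of the lexicographically lowest monomial,
  which is a nonzero constant. The assumption on \<open>K\<close> and \<open>x\<close> covers prime chains, with
  \<open>x i \<in> K (Suc i) - K i\<close>, as well as regular sequences, with \<open>K i\<close> generated by the first \<open>i\<close>
  members.
\<close>

lemma relation_collapses_filtration:
  fixes K :: "nat \<Rightarrow> 'a::comm_ring_1 set" and \<iota> :: "'k::field \<Rightarrow> 'a"
  assumes K: "\<And>i. i \<le> 3 \<Longrightarrow> ideal (K i) cring_class_ops" "\<And>i. i < 3 \<Longrightarrow> K i \<subseteq> K (Suc i)"
    and x: "\<And>i. i < 3 \<Longrightarrow> x i \<in> K (Suc i)" "\<And>i y. i < 3 \<Longrightarrow> x i * y \<in> K i \<Longrightarrow> y \<in> K i"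
    and \<iota>: "unital_hom \<iota>"
    and nz: "\<exists>i\<le>N. \<exists>j\<le>N. \<exists>l\<le>N. c i j l \<noteq> 0"
    and rel: "(\<Sum>i\<le>N. (\<Sum>j\<le>N. (\<Sum>l\<le>N. \<iota> (c i j l) * x 2 ^ l) * x 1 ^ j) * x 0 ^ i) \<in> K 0"
  shows "1 \<in> K 3"
proof -
  interpret unital_hom \<iota> by (rule \<iota>)
  define i0 where "i0 = (LEAST i. i \<le> N \<and> (\<exists>j\<le>N. \<exists>l\<le>N. c i j l \<noteq> 0))"
  have i0: "i0 \<le> N \<and> (\<exists>j\<le>N. \<exists>l\<le>N. c i0 j l \<noteq> 0)"
    unfolding i0_def using nz by (intro LeastI_ex[of "\<lambda>i. i \<le> N \<and> (\<exists>j\<le>N. \<exists>l\<le>N. c i j l \<noteq> 0)"]) auto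
  have i0': "c i j l = 0" if "i < i0" "j \<le> N" "l \<le> N" for i j l
    using not_less_Least[of i "\<lambda>i. i \<le> N \<and> (\<exists>j\<le>N. \<exists>l\<le>N. c i j l \<noteq> 0)", folded i0_def] that i0 by auto
  define j0 where "j0 = (LEAST j. j \<le> N \<and> (\<exists>l\<le>N. c i0 j l \<noteq> 0))"
  have j0: "j0 \<le> N \<and> (\<exists>l\<le>N. c i0 j0 l \<noteq> 0)"
    unfolding j0_def using i0 by (intro LeastI_ex[of "\<lambda>j. j \<le> N \<and> (\<exists>l\<le>N. c i0 j l \<noteq> 0)"]) auto
  have j0': "c i0 j l = 0" if "j < j0" "l \<le> N" for j l
    using not_less_Least[of j "\<lambda>j. j \<le> N \<and> (\<exists>l\<le>N. c i0 j l \<noteq> 0)", folded j0_def] that j0 by auto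
  define l0 where "l0 = (LEAST l. l \<le> N \<and> c i0 j0 l \<noteq> 0)"
  have l0: "l0 \<le> N \<and> c i0 j0 l0 \<noteq> 0"
    unfolding l0_def using j0 by (intro LeastI_ex[of "\<lambda>l. l \<le> N \<and> c i0 j0 l \<noteq> 0"]) auto
  have l0': "c i0 j0 l = 0" if "l < l0" for l
    using not_less_Least[of l "\<lambda>l. l \<le> N \<and> c i0 j0 l \<noteq> 0", folded l0_def] that l0 by auto
  have step: "g m \<in> K (Suc n)"
    if "n < 3" "(\<Sum>i\<le>N. g i * x n ^ i) \<in> K n" "m \<le> N" "\<And>i. i < m \<Longrightarrow> g i = 0" for n g m
    by (rule lowest_coeff_mem[of "K n" "K (Suc n)" "x n"]) (use that K x in auto)
  have "(\<Sum>j\<le>N. (\<Sum>l\<le>N. \<iota> (c i0 j l) * x 2 ^ l) * x 1 ^ j) \<in> K (Suc 0)"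
    by (rule step[OF _ rel]) (simp_all add: i0 i0' hom_0)
  then have "(\<Sum>l\<le>N. \<iota> (c i0 j0 l) * x 2 ^ l) \<in> K (Suc 1)"
    by (intro step[of 1 "\<lambda>j. \<Sum>l\<le>N. \<iota> (c i0 j l) * x 2 ^ l"]) (simp_all add: j0 j0' hom_0)
  then have "\<iota> (c i0 j0 l0) \<in> K (Suc 2)"
    by (intro step[of 2 "\<lambda>l. \<iota> (c i0 j0 l)"]) (simp_all add: l0 l0' hom_0 numeral_2_eq_2)
  then have "\<iota> (c i0 j0 l0) \<in> K 3" by simp
  then have "\<iota> (inverse (c i0 j0 l0)) * \<iota> (c i0 j0 l0) \<in> K 3"
    using ideal_class_mult[OF K(1)] by blast
  then show ?thesis
    using l0 by (simp add: hom_mult[symmetric] hom_1)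
qed

section \<open>The ideal of a set of points\<close>

lemma represents_exists: "\<exists>u. represents u P"
proof -
  have "proj_eq (rep_proj P) (rep_proj P)" by (rule Quotient3_rep_reflp[OF Quotient3_proj])
  then show ?thesis
    using Quotient3_abs_rep[OF Quotient3_proj, of P] by (auto simp: represents_def proj_eq_def)
qed

lemma proj_eq_refl: "u \<noteq> 0 \<Longrightarrow> proj_eq u u"
  unfolding proj_eq_def by (auto intro: exI[of _ 1])

lemma represents_smult:
  assumes "represents u P" "c \<noteq> 0"
  shows "represents (c *s u) P"
proof -
  have u: "u \<noteq> 0" "abs_proj u = P" using assms(1) by (auto simp: represents_def)
  then have "c *s u \<noteq> 0" using assms(2) by (auto simp: vec_eq_iff)
  moreover have "proj_eq u (c *s u)" using u assms(2) calculation by (auto simp: proj_eq_def)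
  ultimately show ?thesis
    using u Quotient3_rel_abs[OF Quotient3_proj, of u "c *s u"] by (simp add: represents_def)
qed

lemma represents_unique:
  assumes "represents u P" "represents v P"
  shows "\<exists>c. c \<noteq> 0 \<and> v = c *s u"
proof -
  have "proj_eq u v"
    using assms Quotient3_rel[OF Quotient3_proj, of u v] proj_eq_refl[of u] proj_eq_refl[of v]
    by (simp add: represents_def)
  then show ?thesis by (auto simp: proj_eq_def)
qed

lemma represents_same: "represents u P \<Longrightarrow> represents u P' \<Longrightarrow> P = P'"
  by (simp add: represents_def)

lemma eval_bipoly_eq_insertion_hom:
  "eval_bipoly f u v = insertion_hom (\<lambda>x. x) (case_sum (($) u) (($) v)) f"
  unfolding eval_bipoly_def insertion_hom_def
  by (simp add: UNIV_Plus_UNIV[symmetric] prod.Plus mult.assoc del: UNIV_Plus_UNIV)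

lemma unital_hom_eval: "unital_hom (\<lambda>f. eval_bipoly f u v)"
  unfolding eval_bipoly_eq_insertion_hom by (rule unital_hom_insertion[OF unital_hom_ident])

lemma eval_const: "eval_bipoly (const c) u v = c"
  by (simp add: eval_bipoly_eq_insertion_hom insertion_hom_const[OF unital_hom_ident])

lemma eval_variable:
  "eval_bipoly (variable (Inl i)) u v = u $ i" "eval_bipoly (variable (Inr j)) u v = v $ j"
  by (simp_all add: eval_bipoly_eq_insertion_hom insertion_hom_variable[OF unital_hom_ident])

lemma poly_eq_0I:
  fixes p :: "'k::field_char_0 poly"
  assumes "\<And>s. s \<noteq> 0 \<Longrightarrow> poly p s = 0"
  shows "p = 0"
proof (rule ccontr)
  assume "p \<noteq> 0"
  then have "finite (insert 0 {x. poly p x = 0})" by (simp add: poly_roots_finite)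
  moreover have "insert 0 {x. poly p x = 0} = UNIV" using assms by auto
  ultimately show False by (simp add: infinite_UNIV_char_0)
qed

text \<open>
  Zero values of \<open>s\<close> and \<open>t\<close> are excluded because only nonzero multiples of representatives are again
  representatives.
\<close>

lemma poly_poly_eq_0I:
  fixes p :: "'k::field_char_0 poly poly"
  assumes "\<And>s t. s \<noteq> 0 \<Longrightarrow> t \<noteq> 0 \<Longrightarrow> poly (poly p [:t:]) s = 0"
  shows "p = 0"
proof -
  have "poly (coeff p i) s = 0" if s: "s \<noteq> 0" for s i
  proof -
    interpret unital_hom "\<lambda>q. poly q s" by (rule unital_hom_poly)
    have "poly (map_poly (\<lambda>q. poly q s) p) t = poly (poly p [:t:]) s" for t
      using poly_map_poly[of p "[:t:]"] by simp
    then have "map_poly (\<lambda>q. poly q s) p = 0"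
      using assms[OF s] by (intro poly_eq_0I) simp
    then show ?thesis
      by (metis coeff_0 coeff_map_poly poly_0)
  qed
  then have "coeff p i = 0" for i by (intro poly_eq_0I)
  then show "p = 0" by (simp add: poly_eq_iff)
qed

lemma unital_hom_const_poly2: "unital_hom (\<lambda>c. [:[:c:]:])"
  by (rule unital_hom_comp[OF unital_hom_const_poly unital_hom_const_poly])

text \<open>
  The restriction of a polynomial to the cone of all \<open>(s u, t v)\<close>. The inner variable of the
  result is \<open>s\<close>, the outer one is \<open>t\<close>.
\<close>

definition cone_map :: "'k::comm_ring_1 ^ 2 \<Rightarrow> 'k ^ 'n \<Rightarrow> ('k, 'n::finite) bipoly \<Rightarrow> 'k poly poly" where
  "cone_map u v = insertion_hom (\<lambda>c. [:[:c:]:]) (case_sum (\<lambda>i. [:[:0, u $ i:]:]) (\<lambda>j. [:0, [:v $ j:]:]))"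

lemma unital_hom_cone_map: "unital_hom (cone_map u v)"
  unfolding cone_map_def by (rule unital_hom_insertion[OF unital_hom_const_poly2])

lemma cone_map_const: "cone_map u v (const c) = [:[:c:]:]"
  unfolding cone_map_def by (rule insertion_hom_const[OF unital_hom_const_poly2])

lemma cone_map_variable:
  "cone_map u v (variable (Inl i)) = [:[:0, u $ i:]:]" "cone_map u v (variable (Inr j)) = [:0, [:v $ j:]:]"
  unfolding cone_map_def by (simp_all add: insertion_hom_variable[OF unital_hom_const_poly2])

lemma poly_cone_map: "poly (poly (cone_map u v f) [:t:]) s = eval_bipoly f (s *s u) (t *s v)"
proof -
  have "poly (poly (cone_map u v f) [:t:]) s =
    insertion_hom (\<lambda>c. poly (poly [:[:c:]:] [:t:]) s)
      (\<lambda>i. poly (poly (case_sum (\<lambda>i. [:[:0, u $ i:]:]) (\<lambda>j. [:0, [:v $ j:]:]) i) [:t:]) s) f"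
    unfolding cone_map_def
    by (rule hom_insertion_hom[OF unital_hom_comp[OF unital_hom_poly unital_hom_poly]])
  also have "(\<lambda>i. poly (poly (case_sum (\<lambda>i. [:[:0, u $ i:]:]) (\<lambda>j. [:0, [:v $ j:]:]) i) [:t:]) s)
      = case_sum (($) (s *s u)) (($) (t *s v))"
    by (auto simp: fun_eq_iff split: sum.splits)
  finally show ?thesis by (simp add: eval_bipoly_eq_insertion_hom)
qed

lemma vanishes_at_iff_cone_map:
  fixes u :: "'k::field_char_0 ^ 2" and v :: "'k ^ 'n::finite"
  assumes "represents u P" "represents v Q"
  shows "vanishes_at f (P, Q) \<longleftrightarrow> cone_map u v f = 0"
proof
  assume "vanishes_at f (P, Q)"
  then have "eval_bipoly f (s *s u) (t *s v) = 0" if "s \<noteq> 0" "t \<noteq> 0" for s t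
    using that represents_smult[OF assms(1)] represents_smult[OF assms(2)] by (simp add: vanishes_at_def)
  then show "cone_map u v f = 0" by (intro poly_poly_eq_0I) (simp add: poly_cone_map)
next
  assume 0: "cone_map u v f = 0"
  show "vanishes_at f (P, Q)"
    unfolding vanishes_at_def
  proof (intro allI impI)
    fix u' v' assume "represents u' (fst (P, Q)) \<and> represents v' (snd (P, Q))"
    then have *: "represents u' P" "represents v' Q" by auto
    obtain s where "u' = s *s u" using represents_unique[OF assms(1) *(1)] by blast
    moreover obtain t where "v' = t *s v" using represents_unique[OF assms(2) *(2)] by blast
    ultimately show "eval_bipoly f u' v' = 0" using poly_cone_map[of u v f t s] 0 by simp
  qed
qed

definition bihom_part :: "nat \<times> nat \<Rightarrow> ('k::comm_ring_1, 'n::finite) bipoly \<Rightarrow> ('k, 'n) bipoly" where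
  "bihom_part d f = (\<Sum>m | m \<in> Poly_Mapping.keys f \<and> bidegree m = d. Poly_Mapping.single m (Poly_Mapping.lookup f m))"

lemma sum_bihom_part: "(\<Sum>d\<in>bidegree ` Poly_Mapping.keys f. bihom_part d f) = f"
  unfolding bihom_part_def
  by (subst (3) sum_monomials, rule sum.group) auto

lemma bihomogeneous_bihom_part: "bihomogeneous (bihom_part d f)"
proof -
  have "Poly_Mapping.keys (bihom_part d f) \<subseteq>
      (\<Union>m\<in>{m. m \<in> Poly_Mapping.keys f \<and> bidegree m = d}.
        Poly_Mapping.keys (Poly_Mapping.single m (Poly_Mapping.lookup f m)))"
    unfolding bihom_part_def by (rule Poly_Mapping.keys_sum)
  then show ?thesis unfolding bihomogeneous_def
    by (intro exI[of _ d]) (auto split: if_splits)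
qed

text \<open>
  The exponents of \<open>s\<close> and \<open>t\<close> record the bidegree, so the bihomogeneous parts of a polynomial can
  be read off from the coefficients of its restriction to the cone.
\<close>

lemma cone_map_single:
  "cone_map u v (Poly_Mapping.single m c) = monom (monom (eval_bipoly (Poly_Mapping.single m c) u v)
     (fst (bidegree m))) (snd (bidegree m))"
proof -
  have x: "[:[:0, a:]:] ^ n = monom (monom (a ^ n) n) 0" for a :: 'a and n
    by (induction n) (simp_all add: monom_0 monom_Suc one_pCons mult.commute smult_monom)
  have y: "[:0, [:a:]:] ^ n = monom (monom (a ^ n) 0) n" for a :: 'a and n
    by (induction n) (simp_all add: monom_0 monom_Suc one_pCons mult.commute smult_monom)
  have 1: "(\<Prod>i\<in>S. [:[:0, u $ i:]:] ^ l i) = monom (monom (\<Prod>i\<in>S. u $ i ^ l i) (\<Sum>i\<in>S. l i)) 0" for S l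
    by (induction S rule: infinite_finite_induct) (simp_all add: x mult_monom)
  have 2: "(\<Prod>j\<in>S. [:0, [:v $ j:]:] ^ l j) = monom (monom (\<Prod>j\<in>S. v $ j ^ l j) 0) (\<Sum>j\<in>S. l j)" for S l
    by (induction S rule: infinite_finite_induct) (simp_all add: y mult_monom)
  show ?thesis
    unfolding cone_map_def eval_bipoly_eq_insertion_hom insertion_hom_single[OF unital_hom_ident] insertion_hom_single[OF unital_hom_const_poly2]
    by (simp add: UNIV_Plus_UNIV[symmetric] prod.Plus 1 2 bidegree_def mult_monom smult_monom mult.assoc del: UNIV_Plus_UNIV)
qed

lemma cone_map_bihom_part:
  "cone_map u v (bihom_part d f) = monom (monom (coeff (coeff (cone_map u v f) (snd d)) (fst d)) (fst d)) (snd d)"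
proof -
  interpret unital_hom "cone_map u v" by (rule unital_hom_cone_map)
  let ?e = "\<lambda>m. eval_bipoly (Poly_Mapping.single m (Poly_Mapping.lookup f m)) u v"
  have "cone_map u v f = (\<Sum>m\<in>Poly_Mapping.keys f. monom (monom (?e m) (fst (bidegree m))) (snd (bidegree m)))"
    by (subst sum_monomials) (simp add: hom_sum cone_map_single)
  then have "coeff (coeff (cone_map u v f) (snd d)) (fst d) =
      (\<Sum>m\<in>Poly_Mapping.keys f. if bidegree m = d then ?e m else 0)"
    by (simp add: coeff_sum) (intro sum.cong refl, auto simp: prod_eq_iff)
  also have "\<dots> = (\<Sum>m | m \<in> Poly_Mapping.keys f \<and> bidegree m = d. ?e m)"
    by (simp add: sum.inter_filter)
  finally show ?thesis
    by (simp add: bihom_part_def hom_sum cone_map_single monom_sum)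
qed

text \<open>
  The right-hand side is an ideal that contains the generators. Conversely, if \<open>f\<close> vanishes at a
  point then so does each bihomogeneous part, because its restriction to the cone consists of the
  terms of one bidegree in the restriction of \<open>f\<close>, which is zero.
\<close>

lemma vanishing_ideal_eq:
  fixes X :: "('k::field_char_0, 'n::finite) bipoint set"
  shows "vanishing_ideal X = {f. \<forall>pt\<in>X. vanishes_at f pt}"
proof
  let ?G = "{f :: ('k, 'n) bipoly. bihomogeneous f \<and> (\<forall>pt\<in>X. vanishes_at f pt)}"
  have "ideal {f. \<forall>pt\<in>X. vanishes_at f pt} (coord_ring :: ('k, 'n) bipoly ring)"
    by (rule ideal_classI)
      (auto simp: vanishes_at_def unital_hom.hom_0[OF unital_hom_eval] unital_hom.hom_add[OF unital_hom_eval]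
        unital_hom.hom_mult[OF unital_hom_eval])
  then show "vanishing_ideal X \<subseteq> {f. \<forall>pt\<in>X. vanishes_at f pt}"
    unfolding vanishing_ideal_def by (rule ring.genideal_minimal[OF cring_class.ring_axioms]) auto
  have id: "ideal (vanishing_ideal X) coord_ring"
    unfolding vanishing_ideal_def
    by (rule ring.genideal_ideal[OF cring_class.ring_axioms]) (simp add: carrier_class subset_iff)
  have sub: "?G \<subseteq> vanishing_ideal X"
    unfolding vanishing_ideal_def
    by (rule ring.genideal_self[OF cring_class.ring_axioms]) (simp add: carrier_class subset_iff)
  show "{f. \<forall>pt\<in>X. vanishes_at f pt} \<subseteq> vanishing_ideal X"
  proof
    fix f assume f: "f \<in> {f. \<forall>pt\<in>X. vanishes_at f pt}"
    have "vanishes_at (bihom_part d f) pt" if pt: "pt \<in> X" for d pt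
    proof -
      obtain P Q where PQ: "pt = (P, Q)" by (cases pt)
      obtain u v where uv: "represents u P" "represents v Q"
        using represents_exists[of P] represents_exists[of Q] by blast
      then have "cone_map u v f = 0" using f pt PQ vanishes_at_iff_cone_map[OF uv] by auto
      then show ?thesis by (simp add: PQ vanishes_at_iff_cone_map[OF uv] cone_map_bihom_part)
    qed
    then have "bihom_part d f \<in> ?G" for d
      using bihomogeneous_bihom_part[of d f] by blast
    then have "bihom_part d f \<in> vanishing_ideal X" for d
      using sub by blast
    then have "(\<Sum>d\<in>bidegree ` Poly_Mapping.keys f. bihom_part d f) \<in> vanishing_ideal X"
      by (intro ideal_class_sum[OF id])
    then show "f \<in> vanishing_ideal X" by (simp add: sum_bihom_part)
  qed
qed

section \<open>Upper bounds for dimension and depth\<close>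

text \<open>
  The common obstruction to chains of four primes and to regular sequences of length three in the
  quotient by \<open>I\<close>, expressed through ideals of the ring itself.
\<close>

definition long_filtrations_collapse :: "'a::comm_ring_1 set \<Rightarrow> bool" where
  "long_filtrations_collapse I \<longleftrightarrow>
     (\<forall>K x. (\<forall>i\<le>3. ideal (K i) cring_class_ops) \<longrightarrow> (\<forall>i<3. K i \<subseteq> K (Suc i)) \<longrightarrow> I \<subseteq> K 0 \<longrightarrow>
        (\<forall>i<3. x i \<in> K (Suc i)) \<longrightarrow> (\<forall>i<3. \<forall>y. x i * y \<in> K i \<longrightarrow> y \<in> K i) \<longrightarrow> 1 \<in> K (3 :: nat))"

lemma long_filtrations_collapseD:
  assumes "long_filtrations_collapse I"
    and "\<And>i. i \<le> 3 \<Longrightarrow> ideal (K i) cring_class_ops" "\<And>i. i < 3 \<Longrightarrow> K i \<subseteq> K (Suc i)" "I \<subseteq> K 0"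
    and "\<And>i. i < 3 \<Longrightarrow> x i \<in> K (Suc i)" "\<And>i y. i < 3 \<Longrightarrow> x i * y \<in> K i \<Longrightarrow> y \<in> K i"
  shows "1 \<in> K 3"
  by (rule assms(1)[unfolded long_filtrations_collapse_def, rule_format, of K x]) (fact assms)+

lemma ideal_vanishing_ideal: "ideal (vanishing_ideal X) coord_ring"
  unfolding vanishing_ideal_def
  by (rule ring.genideal_ideal[OF cring_class.ring_axioms]) (simp add: carrier_class subset_iff)

lemma vanishing_ideal_collapse:
  fixes X :: "('k::field_char_0, 'n::finite) bipoint set"
  assumes "finite X"
  shows "long_filtrations_collapse (vanishing_ideal X)"
  unfolding long_filtrations_collapse_def
proof (intro allI impI)
  fix K :: "nat \<Rightarrow> ('k, 'n) bipoly set" and x :: "nat \<Rightarrow> ('k, 'n) bipoly"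
  assume K: "\<forall>i\<le>3. ideal (K i) coord_ring" "\<forall>i<3. K i \<subseteq> K (Suc i)" "vanishing_ideal X \<subseteq> K 0"
    and x: "\<forall>i<3. x i \<in> K (Suc i)" "\<forall>i<3. \<forall>y. x i * y \<in> K i \<longrightarrow> y \<in> K i"
  define \<theta> where "\<theta> = (\<lambda>pt :: ('k, 'n) bipoint.
    cone_map (SOME u. represents u (fst pt)) (SOME v. represents v (snd pt)) :: ('k, 'n) bipoly \<Rightarrow> _)"
  have \<theta>: "unital_hom (\<theta> pt)" "\<theta> pt (const a) = [:[:a:]:]" for pt a
    by (simp_all add: \<theta>_def unital_hom_cone_map cone_map_const)
  obtain N c where nz: "\<exists>i\<le>N. \<exists>j\<le>N. \<exists>l\<le>N. c i j l \<noteq> 0"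
    and rel: "\<forall>pt\<in>X. \<theta> pt (\<Sum>i\<le>N. (\<Sum>j\<le>N. (\<Sum>l\<le>N. const (c i j l) * x 2 ^ l) * x 1 ^ j) * x 0 ^ i) = 0"
    using algebraic_relation[OF assms, of \<theta> const "x 2" "x 1" "x 0", OF \<theta>] by blast
  have "vanishes_at f pt \<longleftrightarrow> \<theta> pt f = 0" for f pt
    using vanishes_at_iff_cone_map[OF someI_ex[OF represents_exists] someI_ex[OF represents_exists], of f "fst pt" "snd pt"]
    by (simp add: \<theta>_def)
  then have "(\<Sum>i\<le>N. (\<Sum>j\<le>N. (\<Sum>l\<le>N. const (c i j l) * x 2 ^ l) * x 1 ^ j) * x 0 ^ i) \<in> K 0"
    using rel K(3) by (auto simp: vanishing_ideal_eq)
  then show "1 \<in> K 3"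
    by (intro relation_collapses_filtration[where x = x and K = K, OF _ _ _ _ unital_hom_const nz]) (use K x in auto)
qed

lemma regular_sequence_length_le_depth:
  "regular_sequence S fs \<Longrightarrow> set fs \<subseteq> J \<Longrightarrow> enat (length fs) \<le> depth_wrt S J"
  unfolding depth_wrt_def by (rule Sup_upper) auto

lemma prime_chain_le_krull_dim: "prime_chain S d p \<Longrightarrow> enat d \<le> krull_dim S"
  unfolding krull_dim_def by (rule Sup_upper) auto

context class_quotient
begin

lemma proj_0: "proj_Q 0 = \<zero>\<^bsub>Q\<^esub>"
  using proj.hom_zero by (simp add: zero_class)

lemma subset_vimage: "ideal K Q \<Longrightarrow> I \<subseteq> proj_Q -` K"
  using proj_eq_iff[of _ 0] additive_subgroup.zero_closed[OF ideal.axioms(1), of K Q]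
  by (auto simp: proj_0)

lemma carrier_if_one_mem: "ideal K Q \<Longrightarrow> 1 \<in> proj_Q -` K \<Longrightarrow> K = carrier Q"
  using ideal.one_imp_carrier[of K Q] proj.hom_one by (simp add: one_class)

lemma krull_dim_le_2:
  assumes "long_filtrations_collapse I"
  shows "krull_dim Q \<le> 2"
  unfolding krull_dim_def
proof (rule Sup_least, clarify)
  fix d p assume "prime_chain Q d p"
  then have p: "\<And>i. i \<le> d \<Longrightarrow> primeideal (p i) Q" "\<And>i. i < d \<Longrightarrow> p i \<subset> p (Suc i)"
    by (auto simp: prime_chain_def)
  show "enat d \<le> 2"
  proof (rule ccontr)
    assume "\<not> enat d \<le> 2"
    then have d: "3 \<le> d" by (simp add: numeral_eq_enat)
    have pid: "ideal (p i) Q" if "i \<le> 3" for i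
      using p(1)[of i] d that by (simp add: primeideal_def)
    have "\<exists>x. proj_Q x \<in> p (Suc i) - p i" if i: "i < 3" for i
    proof -
      obtain a where a: "a \<in> p (Suc i)" "a \<notin> p i" using p(2)[of i] d i by auto
      have "a \<in> carrier Q"
        using ideal.Icarr[OF pid[of "Suc i"] a(1)] i by simp
      then show ?thesis using a by (auto simp: carrier_Q)
    qed
    then obtain x where x: "\<And>i. i < 3 \<Longrightarrow> proj_Q (x i) \<in> p (Suc i) - p i" by metis
    have "1 \<in> proj_Q -` p 3"
    proof (rule long_filtrations_collapseD[OF assms, where K = "\<lambda>i. proj_Q -` p i" and x = x])
      show "y \<in> proj_Q -` p i" if "i < 3" "x i * y \<in> proj_Q -` p i" for i y
        using that x[OF that(1)] primeideal.I_prime[of "p i" Q "proj_Q (x i)" "proj_Q y"] p(1)[of i] d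
        by (simp add: proj_mult carrier_Q)
      show "proj_Q -` p i \<subseteq> proj_Q -` p (Suc i)" if "i < 3" for i
        using p(2)[of i] d that by auto
      show "x i \<in> proj_Q -` p (Suc i)" if "i < 3" for i
        using x[OF that] by simp
    qed (simp_all add: ideal_vimage pid subset_vimage)
    then have "p 3 = carrier Q" by (intro carrier_if_one_mem pid) auto
    then show False using primeideal.I_notcarr[OF p(1)[OF d]] by simp
  qed
qed

lemma depth_le_2:
  assumes "long_filtrations_collapse I"
  shows "depth_wrt Q J \<le> 2"
  unfolding depth_wrt_def
proof (rule Sup_least, clarify)
  fix fs assume fs: "regular_sequence Q fs"
  show "enat (length fs) \<le> 2"
  proof (rule ccontr)
    assume "\<not> enat (length fs) \<le> 2"
    then have len: "3 \<le> length fs" by (simp add: numeral_eq_enat)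
    have sub: "set (take i fs) \<subseteq> carrier Q" for i
      using fs set_take_subset[of i fs] by (auto simp: regular_sequence_def)
    define p where "p i = genideal Q (set (take i fs))" for i
    have pid: "ideal (p i) Q" for i
      unfolding p_def by (rule proj.S.genideal_ideal[OF sub])
    have gen: "set (take i fs) \<subseteq> p i" for i
      unfolding p_def by (rule proj.S.genideal_self[OF sub])
    have mono: "p i \<subseteq> p j" if "i \<le> j" for i j
      unfolding p_def[of i]
      by (rule proj.S.genideal_minimal[OF pid]) (use gen[of j] set_take_subset_set_take[OF that, of fs] in auto)
    have "fs ! i \<in> carrier Q" if "i < 3" for i
      using fs nth_mem[OF less_le_trans[OF that len]] unfolding regular_sequence_def by blast
    then have "\<exists>x. fs ! i = proj_Q x" if "i < 3" for i
      using that unfolding carrier_Q by blast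
    then obtain x where x: "\<And>i. i < 3 \<Longrightarrow> fs ! i = proj_Q (x i)" by metis
    have "1 \<in> proj_Q -` p 3"
    proof (rule long_filtrations_collapseD[OF assms, where K = "\<lambda>i. proj_Q -` p i" and x = x])
      show "x i \<in> proj_Q -` p (Suc i)" if "i < 3" for i
        using gen[of "Suc i"] len that x[OF that] by (auto simp: take_Suc_conv_app_nth)
      show "y \<in> proj_Q -` p i" if "i < 3" "x i * y \<in> proj_Q -` p i" for i y
      proof -
        have "\<forall>a\<in>carrier Q. fs ! i \<otimes>\<^bsub>Q\<^esub> a \<in> p i \<longrightarrow> a \<in> p i"
          using fs len that(1) by (simp add: regular_sequence_def p_def)
        then show ?thesis using that x[OF that(1)] by (simp add: proj_mult carrier_Q)
      qed
      show "proj_Q -` p i \<subseteq> proj_Q -` p (Suc i)" for i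
        by (rule vimage_mono[OF mono]) simp
    qed (simp_all add: ideal_vimage pid subset_vimage)
    then have "1 \<in> proj_Q -` p (length fs)" using mono[OF len] by auto
    then have "p (length fs) = carrier Q" by (rule carrier_if_one_mem[OF pid])
    then show False using fs by (simp add: regular_sequence_def p_def)
  qed
qed

end

section \<open>A chain of three primes\<close>

lemma (in class_quotient) prime_kernel:
  fixes h :: "'a \<Rightarrow> 'b::idom"
  assumes "unital_hom h" "\<And>f. f \<in> I \<Longrightarrow> h f = 0"
  shows "primeideal (proj_Q ` {f. h f = 0}) Q"
proof -
  interpret unital_hom h by fact
  show ?thesis
    by (rule primeideal_image[OF ideal_kernel]) (use assms(2) in \<open>auto simp: hom_1 hom_mult\<close>)
qed

lemma krull_dim_ge_2:
  fixes X :: "('k::field_char_0, 'n::finite) bipoint set"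
  assumes "X \<noteq> {}"
  shows "2 \<le> krull_dim (coord_ring Quot vanishing_ideal X)"
proof -
  interpret class_quotient "vanishing_ideal X"
    by (rule class_quotient.intro[OF ideal_vanishing_ideal])
  obtain P R where PR: "(P, R) \<in> X" using assms by auto
  obtain u where u: "represents u P" using represents_exists by blast
  obtain v where v: "represents v R" using represents_exists by blast
  obtain k where k: "u $ k \<noteq> 0" using u by (auto simp: represents_def vec_eq_iff)
  obtain j where j: "v $ j \<noteq> 0" using v by (auto simp: represents_def vec_eq_iff)
  let ?h0 = "cone_map u v"
  let ?h1 = "\<lambda>f. poly (?h0 f) 0"
  let ?h2 = "\<lambda>f. poly (?h1 f) 0"
  have vanish: "?h0 f = 0" if "f \<in> vanishing_ideal X" for f
    using that PR by (auto simp: vanishing_ideal_eq vanishes_at_iff_cone_map[OF u v])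
  have hom1: "unital_hom ?h1" by (rule unital_hom_comp[OF unital_hom_poly unital_hom_cone_map])
  have hom2: "unital_hom ?h2" by (rule unital_hom_comp[OF unital_hom_poly hom1])
  define p where "p = (\<lambda>i :: nat. if i = 0 then {f. ?h0 f = 0} else if i = 1 then {f. ?h1 f = 0} else {f. ?h2 f = 0})"
  have id: "ideal (p i) coord_ring" "vanishing_ideal X \<subseteq> p i" for i
    using vanish unital_hom.ideal_kernel[OF unital_hom_cone_map] unital_hom.ideal_kernel[OF hom1]
      unital_hom.ideal_kernel[OF hom2] by (auto simp: p_def)
  have "primeideal (proj_Q ` p i) Q" for i
    using vanish prime_kernel[OF unital_hom_cone_map] prime_kernel[OF hom1] prime_kernel[OF hom2]
    by (simp add: p_def)
  moreover have "proj_Q ` p i \<subset> proj_Q ` p (Suc i)" if "i < 2" for i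
  proof -
    have "\<exists>f. f \<in> p (Suc i) \<and> f \<notin> p i"
    proof (cases "i = 0")
      case True
      then show ?thesis using j
        by (intro exI[of _ "variable (Inr j)"]) (simp add: p_def cone_map_variable)
    next
      case False
      then show ?thesis using k that
        by (intro exI[of _ "variable (Inl k)"]) (simp add: p_def cone_map_variable)
    qed
    then obtain f where "f \<in> p (Suc i)" "f \<notin> p i" by blast
    moreover have "p i \<subseteq> p (Suc i)" using that by (auto simp: p_def)
    ultimately show ?thesis using proj_image_iff[OF id, of f i] by blast
  qed
  ultimately have "prime_chain Q 2 (\<lambda>i. proj_Q ` p i)" by (simp add: prime_chain_def)
  then show ?thesis
    using prime_chain_le_krull_dim[of Q 2] by (simp add: numeral_eq_enat)
qed

section \<open>A regular sequence of length two\<close>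

text \<open>
  Here \<open>J\<close> plays the role of \<open>I + (l)\<close>: by the assumptions it contains both summands and is contained
  in the sum. The ideal \<open>M\<close> witnesses that \<open>l\<close> and \<open>m\<close> generate a proper ideal of the quotient.
\<close>

lemma (in class_quotient) regular_pair:
  assumes l: "\<And>y. l * y \<in> I \<Longrightarrow> y \<in> I"
    and J: "ideal J cring_class_ops" "I \<subseteq> J" "l \<in> J" "\<And>f. f \<in> J \<Longrightarrow> \<exists>g\<in>I. l dvd f - g"
    and m: "\<And>y. m * y \<in> J \<Longrightarrow> y \<in> J"
    and M: "ideal M cring_class_ops" "I \<subseteq> M" "l \<in> M" "m \<in> M" "1 \<notin> M"
  shows "regular_sequence Q [proj_Q l, proj_Q m]"
proof -
  have genideal: "ideal (genideal Q S) Q" if "S \<subseteq> carrier Q" for S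
    using that by (rule proj.S.genideal_ideal)
  have first: "a \<in> genideal Q {}" if aQ: "a \<in> carrier Q" "proj_Q l \<otimes>\<^bsub>Q\<^esub> a \<in> genideal Q {}" for a
  proof -
    obtain y where y: "a = proj_Q y" using aQ(1) by (auto simp: carrier_Q)
    have "genideal Q {} \<subseteq> proj_Q ` I"
      by (rule proj.S.genideal_minimal[OF ideal_image[OF ideal_I]]) simp
    then have "proj_Q (l * y) \<in> proj_Q ` I" using aQ(2) y by (auto simp: proj_mult)
    then have "y \<in> I" using proj_image_iff[OF ideal_I] l by blast
    then show ?thesis using subset_vimage[OF genideal[of "{}"]] y by auto
  qed
  have second: "a \<in> genideal Q {proj_Q l}"
    if aQ: "a \<in> carrier Q" "proj_Q m \<otimes>\<^bsub>Q\<^esub> a \<in> genideal Q {proj_Q l}" for a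
  proof -
    obtain y where y: "a = proj_Q y" using aQ(1) by (auto simp: carrier_Q)
    have l_gen: "proj_Q l \<in> genideal Q {proj_Q l}"
      by (rule proj.S.genideal_self') (simp add: carrier_Q)
    have "genideal Q {proj_Q l} \<subseteq> proj_Q ` J"
      by (rule proj.S.genideal_minimal[OF ideal_image[OF J(1)]]) (use J(3) in simp)
    then have "proj_Q (m * y) \<in> proj_Q ` J" using aQ(2) y by (auto simp: proj_mult)
    then have "y \<in> J" using proj_image_iff[OF J(1,2)] m by blast
    then obtain g h where gh: "g \<in> I" "y - g = l * h" using J(4) by (metis dvdE)
    have "y - l * h = g" using gh(2) by (simp add: algebra_simps)
    then have "a = proj_Q (l * h)" using gh(1) y by (simp add: proj_eq_iff)
    then show ?thesis
      using ideal.I_r_closed[OF genideal[of "{proj_Q l}"] l_gen, of "proj_Q h"]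
      by (simp add: proj_mult carrier_Q)
  qed
  have "genideal Q {proj_Q l, proj_Q m} \<subseteq> proj_Q ` M"
    by (rule proj.S.genideal_minimal[OF ideal_image[OF M(1)]]) (use M(3,4) in simp)
  moreover have "proj_Q 1 \<notin> proj_Q ` M" using proj_image_iff[OF M(1,2)] M(5) by blast
  ultimately have "genideal Q {proj_Q l, proj_Q m} \<noteq> carrier Q"
    unfolding carrier_Q by (metis rangeI subsetD)
  then show ?thesis
    using first second by (auto simp: regular_sequence_def less_Suc_eq carrier_Q)
qed

text \<open>
  A form whose coefficients are distinct powers of \<open>z\<close> takes at \<open>v\<close> the value at \<open>z\<close> of a
  polynomial whose coefficients are the coordinates of \<open>v\<close>. Only finitely many \<open>z\<close> are a root for
  some \<open>v \<in> V\<close>.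
\<close>

lemma hyperplane_avoiding_finite:
  fixes V :: "('k::field_char_0 ^ 'n::finite) set"
  assumes "finite V" "0 \<notin> V"
  shows "\<exists>a. \<forall>v\<in>V. (\<Sum>j\<in>UNIV. a $ j * v $ j) \<noteq> 0"
proof -
  obtain e :: "'n \<Rightarrow> nat" where e: "inj e"
    using finite_imp_inj_to_nat_seg[of "UNIV :: 'n set"] by auto
  define p where "p v = (\<Sum>j\<in>UNIV. monom (v $ j) (e j))" for v :: "'k ^ 'n"
  have "p v \<noteq> 0" if v: "v \<in> V" for v
  proof -
    obtain j where "v $ j \<noteq> 0" using v assms(2) by (metis vec_eq_iff zero_index)
    moreover have "coeff (p v) (e j) = (\<Sum>i\<in>UNIV. if i = j then v $ i else 0)"
      unfolding p_def coeff_sum using e by (intro sum.cong) (auto dest: injD)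
    ultimately show ?thesis by auto
  qed
  then have "(\<Prod>v\<in>V. p v) \<noteq> 0" using assms(1) by simp
  then have "finite {z. poly (\<Prod>v\<in>V. p v) z = 0}" by (rule poly_roots_finite)
  then obtain z where "poly (\<Prod>v\<in>V. p v) z \<noteq> 0"
    using infinite_UNIV_char_0[where 'a = 'k] by (metis (mono_tags, lifting) Collect_cong UNIV_def)
  then have "poly (p v) z \<noteq> 0" if "v \<in> V" for v
    using that assms(1) by (simp add: poly_prod)
  then show ?thesis
    by (intro exI[of _ "\<chi> j. z ^ e j"]) (simp add: p_def poly_sum poly_monom mult.commute)
qed

lemma prod_roots_dvd:
  fixes p :: "'a::idom poly"
  assumes "finite S" "\<And>a. a \<in> S \<Longrightarrow> poly p a = 0"
  shows "(\<Prod>a\<in>S. [:- a, 1:]) dvd p"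
  using assms
proof (induction S arbitrary: p rule: finite_induct)
  case (insert a S)
  obtain q where q: "p = [:- a, 1:] * q"
    using insert.prems[of a] by (auto simp: poly_eq_0_iff_dvd)
  have "poly q b = 0" if "b \<in> S" for b
  proof -
    have "b \<noteq> a" using that insert.hyps by auto
    then show ?thesis using insert.prems[of b] that by (simp add: q)
  qed
  then have "(\<Prod>a\<in>S. [:- a, 1:]) dvd q" by (rule insert.IH)
  from mult_dvd_mono[OF dvd_refl this, of "[:- a, 1:]"] show ?case
    using insert.hyps by (simp only: q prod.insert not_False_eq_True if_False)
qed simp

lemma card_Union_chain_le:
  assumes "finite \<C>" "\<And>A B. A \<in> \<C> \<Longrightarrow> B \<in> \<C> \<Longrightarrow> A \<subseteq> B \<or> B \<subseteq> A" "\<And>A. A \<in> \<C> \<Longrightarrow> card A \<le> d"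
  shows "card (\<Union>\<C>) \<le> d"
proof (cases "\<C> = {}")
  case False
  have "\<Union>\<C> \<in> \<C>"
    by (rule Union_in_chain[OF assms(1) False, of UNIV]) (use assms(2) in \<open>auto simp: subset_chain_def\<close>)
  then show ?thesis by (rule assms(3))
qed simp

text \<open>
  The point \<open>(c : 1)\<close> of the projective line is not the first component of a point of \<open>X\<close>; it is
  the zero of the linear form \<open>ell\<close>. The index type \<open>2\<close> consists of \<open>1\<close> and \<open>2 = 0\<close>.
\<close>

locale generic_line =
  fixes X :: "('k::field_char_0, 'n::finite) bipoint set" and c :: 'k
  assumes finite_X: "finite X" and star: "property_star X"
    and c_generic: "\<And>P R u. (P, R) \<in> X \<Longrightarrow> represents u P \<Longrightarrow> u $ 1 \<noteq> c * u $ 2"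
begin

definition ell :: "('k, 'n) bipoly" where
  "ell = variable (Inl 1) - const c * variable (Inl 2)"

definition fibre :: "('k, 'n) proj \<Rightarrow> ('k, 2) proj set" where
  "fibre R = {P. (P, R) \<in> X}"

text \<open>
  The polynomial \<open>f(c z, z, v)\<close> in \<open>z\<close>: the coefficient of \<open>z ^ d\<close> is the value at the zero of
  \<open>ell\<close> of the part of \<open>f\<close> that has degree \<open>d\<close> in the first group of variables.
\<close>

definition line_restriction :: "'k ^ 'n \<Rightarrow> ('k, 'n) bipoly \<Rightarrow> 'k poly" where
  "line_restriction v = insertion_hom (\<lambda>a. [:a:])
     (case_sum (\<lambda>i. if i = 1 then [:0, c:] else [:0, 1:]) (\<lambda>j. [:v $ j:]))"

text \<open>
  This turns out to be the sum of the vanishing ideal and the ideal generated by \<open>ell\<close>.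
\<close>

definition fibre_order_ideal :: "('k, 'n) bipoly set" where
  "fibre_order_ideal = {f. \<forall>R\<in>snd ` X. \<forall>v. represents v R \<longrightarrow> [:0, 1:] ^ card (fibre R) dvd line_restriction v f}"

lemma unital_hom_line_restriction: "unital_hom (line_restriction v)"
  unfolding line_restriction_def by (rule unital_hom_insertion[OF unital_hom_const_poly])

lemma line_restriction_variable: "line_restriction v (variable (Inl 1)) = [:0, c:]" "line_restriction v (variable (Inl 2)) = [:0, 1:]"
   "line_restriction v (variable (Inr j)) = [:v $ j:]" "line_restriction v (const a) = [:a:]"
  unfolding line_restriction_def
  by (simp_all add: insertion_hom_variable[OF unital_hom_const_poly] insertion_hom_const[OF unital_hom_const_poly])

lemma eval_ell: "eval_bipoly ell u v = u $ 1 - c * u $ 2"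
  by (simp add: ell_def unital_hom.hom_diff[OF unital_hom_eval] unital_hom.hom_mult[OF unital_hom_eval]
      eval_variable eval_const)

lemma finite_fibre: "finite (fibre R)"
  by (rule finite_subset[of _ "fst ` X"]) (use finite_X in \<open>force simp: fibre_def\<close>)+

text \<open>
  If \<open>P\<close> lay only in the first fibre and \<open>P'\<close> only in the second, then \<open>(P, R)\<close> and \<open>(P', R')\<close>
  would violate property \<open>(\<star>)\<close>.
\<close>

lemma fibre_chain: "fibre R \<subseteq> fibre R' \<or> fibre R' \<subseteq> fibre R"
proof (rule ccontr)
  assume "\<not> ?thesis"
  then obtain P P' where P: "(P, R) \<in> X" "(P, R') \<notin> X" "(P', R') \<in> X" "(P', R) \<notin> X"
    by (auto simp: fibre_def)
  then have "P \<noteq> P'" "R \<noteq> R'" by auto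
  then show False using star P unfolding property_star_def by blast
qed

lemma ideal_fibre_order_ideal: "ideal fibre_order_ideal coord_ring"
  by (rule ideal_classI)
    (auto simp: fibre_order_ideal_def unital_hom.hom_0[OF unital_hom_line_restriction]
      unital_hom.hom_add[OF unital_hom_line_restriction] unital_hom.hom_mult[OF unital_hom_line_restriction])

lemma ell_mem_fibre_order_ideal: "ell \<in> fibre_order_ideal"
  by (simp add: fibre_order_ideal_def ell_def unital_hom.hom_diff[OF unital_hom_line_restriction]
      unital_hom.hom_mult[OF unital_hom_line_restriction] line_restriction_variable)

lemma fibre_order_ideal_cancel:
  assumes "\<And>R v. R \<in> snd ` X \<Longrightarrow> represents v R \<Longrightarrow> \<exists>a. a \<noteq> 0 \<and> line_restriction v m = [:a:]" "m * y \<in> fibre_order_ideal"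
  shows "y \<in> fibre_order_ideal"
  unfolding fibre_order_ideal_def
proof (intro CollectI ballI allI impI)
  fix R v assume R: "R \<in> snd ` X" "represents v R"
  then obtain a where "a \<noteq> 0" "line_restriction v m = [:a:]" using assms(1) by blast
  moreover have "[:0, 1:] ^ card (fibre R) dvd line_restriction v (m * y)"
    using assms(2) R by (auto simp: fibre_order_ideal_def)
  ultimately show "[:0, 1:] ^ card (fibre R) dvd line_restriction v y"
    by (simp add: unital_hom.hom_mult[OF unital_hom_line_restriction] dvd_smult_iff)
qed

lemma ell_cancel:
  assumes "ell * y \<in> vanishing_ideal X"
  shows "y \<in> vanishing_ideal X"
proof -
  have "eval_bipoly y u v = 0" if "(P, R) \<in> X" "represents u P" "represents v R" for P R u v
  proof -
    have "eval_bipoly (ell * y) u v = 0"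
      using assms that by (auto simp: vanishing_ideal_eq vanishes_at_def)
    then show ?thesis
      using c_generic[OF that(1,2)] by (simp add: unital_hom.hom_mult[OF unital_hom_eval] eval_ell)
  qed
  then show ?thesis by (auto simp: vanishing_ideal_eq vanishes_at_def)
qed

text \<open>
  Each \<open>P\<close> in the fibre over \<open>R\<close> differs from \<open>(c : 1)\<close>, so it is represented by
  \<open>(1, 0) + b (c, 1)\<close> for a unique \<open>b\<close>. Put \<open>F(z, y) = f(z (1, 0) + y (c, 1), v)\<close>. Since \<open>f\<close>
  vanishes on the line through \<open>P\<close>, the polynomial \<open>F\<close> has the root \<open>y = b z\<close>. Hence \<open>F\<close> is
  divisible by the product of all \<open>y - b z\<close>, and \<open>z = 0\<close> gives the claim.
\<close>

lemma vanishing_ideal_subset_fibre_order_ideal: "vanishing_ideal X \<subseteq> fibre_order_ideal"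
proof
  fix f assume f: "f \<in> vanishing_ideal X"
  show "f \<in> fibre_order_ideal"
    unfolding fibre_order_ideal_def
  proof (intro CollectI ballI allI impI)
    fix R v assume R: "R \<in> snd ` X" "represents v R"
    \<comment> \<open>The outer variable of \<open>F\<close> is \<open>y\<close>, the inner one is \<open>z\<close>.\<close>
    define F where "F = insertion_hom (\<lambda>a. [:[:a:]:])
      (case_sum (\<lambda>i. if i = (1::2) then [:[:0, 1:], [:c:]:] else [:0, 1:]) (\<lambda>j. [:[:v $ j:]:])) f"
    define u where "u = (\<lambda>P. SOME u. represents u (P :: ('k, 2) proj))"
    have u: "represents (u P) P" for P unfolding u_def by (rule someI_ex[OF represents_exists])
    define b where "b = (\<lambda>P. u P $ 2 / (u P $ 1 - c * u P $ 2))"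
    have w: "represents (\<chi> i. if i = 1 then 1 + c * b P else b P) P" if "P \<in> fibre R" for P
    proof -
      have d: "u P $ 1 - c * u P $ 2 \<noteq> 0" using c_generic[OF _ u[of P]] that by (auto simp: fibre_def)
      have "(\<chi> i. if i = 1 then 1 + c * b P else b P) = (1 / (u P $ 1 - c * u P $ 2)) *s u P"
        using d by (simp add: vec_eq_iff forall_2 b_def field_simps)
      then show ?thesis using represents_smult[OF u[of P], of "1 / (u P $ 1 - c * u P $ 2)"] d by simp
    qed
    have inj: "inj_on (\<lambda>P. [:0, b P:]) (fibre R)"
    proof (rule inj_onI)
      fix P P' assume P: "P \<in> fibre R" "P' \<in> fibre R" "[:0, b P:] = [:0, b P':]"
      then have b: "b P = b P'" by simp
      have "represents (\<chi> i. if i = 1 then 1 + c * b P' else b P') P"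
        using w[OF P(1)] unfolding b .
      then show "P = P'" using w[OF P(2)] by (rule represents_same)
    qed
    have "poly F [:0, b P:] = 0" if P: "P \<in> fibre R" for P
    proof (rule poly_eq_0I)
      fix s :: 'k assume s: "s \<noteq> 0"
      let ?w = "\<chi> i. if i = 1 then 1 + c * b P else b P"
      have "poly (poly F [:0, b P:]) s = insertion_hom (\<lambda>a. poly (poly [:[:a:]:] [:0, b P:]) s)
        (\<lambda>i. poly (poly (case_sum (\<lambda>i. if i = (1::2) then [:[:0, 1:], [:c:]:] else [:0, 1:]) (\<lambda>j. [:[:v $ j:]:]) i) [:0, b P:]) s) f"
        unfolding F_def by (rule hom_insertion_hom[OF unital_hom_comp[OF unital_hom_poly unital_hom_poly]])
      also have "(\<lambda>i. poly (poly (case_sum (\<lambda>i. if i = (1::2) then [:[:0, 1:], [:c:]:] else [:0, 1:]) (\<lambda>j. [:[:v $ j:]:]) i) [:0, b P:]) s)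
        = case_sum (($) (s *s ?w)) (($) v)"
        by (auto simp: fun_eq_iff algebra_simps split: sum.splits)
      finally have "poly (poly F [:0, b P:]) s = eval_bipoly f (s *s ?w) v"
        by (simp add: eval_bipoly_eq_insertion_hom)
      also have "\<dots> = 0"
        using f represents_smult[OF w[OF P] s] R(2) P by (auto simp: vanishing_ideal_eq vanishes_at_def fibre_def)
      finally show "poly (poly F [:0, b P:]) s = 0" .
    qed
    then have "(\<Prod>a\<in>(\<lambda>P. [:0, b P:]) ` fibre R. [:- a, 1:]) dvd F"
      by (intro prod_roots_dvd) (auto simp: finite_fibre)
    then obtain G where G: "F = (\<Prod>P\<in>fibre R. [:- [:0, b P:], 1:]) * G"
      by (auto simp: prod.reindex[OF inj] elim: dvdE)
    interpret at0: unital_hom "map_poly (\<lambda>p :: 'k poly. poly p 0)"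
      by (rule unital_hom.unital_hom_map_poly[OF unital_hom_poly])
    have "map_poly (\<lambda>p. poly p 0) F = [:0, 1:] ^ card (fibre R) * map_poly (\<lambda>p. poly p 0) G"
      by (simp add: G at0.hom_mult at0.hom_prod map_poly_pCons)
    moreover have "map_poly (\<lambda>p. poly p 0) F = line_restriction v f"
      unfolding F_def line_restriction_def hom_insertion_hom[OF at0.unital_hom_axioms]
      by (rule arg_cong3[where f = insertion_hom]) (auto simp: fun_eq_iff map_poly_pCons split: sum.splits)
    ultimately show "[:0, 1:] ^ card (fibre R) dvd line_restriction v f" by simp
  qed
qed

text \<open>
  Modulo \<open>ell\<close> the variable \<open>x\<^sub>1\<close> may be replaced by \<open>c x\<^sub>2\<close>, which turns \<open>f\<close> into the sum of
  \<open>f\<^sub>d x\<^sub>2 ^ d\<close> with \<open>f\<^sub>d\<close> depending on the second group of variables only. By assumption \<open>f\<^sub>d\<close>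
  vanishes at every \<open>R\<close> with more than \<open>d\<close> points in its fibre. The other fibres form a chain, so
  their union \<open>S\<close> has at most \<open>d\<close> points. For each \<open>P \<in> S\<close> one factor \<open>x\<^sub>2\<close> is replaced by a linear
  form that vanishes at \<open>P\<close> and is congruent to \<open>x\<^sub>2\<close> modulo \<open>ell\<close>. The resulting multiple
  of \<open>f\<^sub>d\<close> vanishes on all of \<open>X\<close>.
\<close>

lemma fibre_order_ideal_subset:
  assumes f: "f \<in> fibre_order_ideal"
  shows "\<exists>g\<in>vanishing_ideal X. ell dvd f - g"
proof -
  let ?x2 = "variable (Inl 2) :: ('k, 'n) bipoly"
  \<comment> \<open>The coefficients of \<open>\<Psi>\<close> are the \<open>f\<^sub>d\<close>; its variable stands for \<open>x\<^sub>2\<close>.\<close>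
  define \<Psi> where "\<Psi> = insertion_hom (\<lambda>a. [:const a:])
    (case_sum (\<lambda>i. if i = (1::2) then [:0, const c:] else [:0, 1:]) (\<lambda>j. [:variable (Inr j) :: ('k, 'n) bipoly:])) f"
  have coeff_vanish: "eval_bipoly (coeff \<Psi> d) u v = 0"
    if "R \<in> snd ` X" "represents v R" "d < card (fibre R)" for d u v R
  proof -
    interpret ev: unital_hom "\<lambda>g. eval_bipoly g u v" by (rule unital_hom_eval)
    have "map_poly (\<lambda>g. eval_bipoly g u v) \<Psi> = line_restriction v f"
      unfolding \<Psi>_def line_restriction_def hom_insertion_hom[OF ev.unital_hom_map_poly]
      by (rule arg_cong3[where f = insertion_hom])
        (auto simp: fun_eq_iff map_poly_pCons eval_const eval_variable ev.hom_0 ev.hom_1 split: sum.splits)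
    then have "eval_bipoly (coeff \<Psi> d) u v = coeff (line_restriction v f) d"
      by (metis coeff_map_poly ev.hom_0)
    moreover have "monom 1 (card (fibre R)) dvd line_restriction v f"
      using f that(1,2) by (auto simp: fibre_order_ideal_def monom_altdef)
    ultimately show ?thesis using that(3) by (simp add: monom_1_dvd_iff')
  qed
  have ell_dvd: "ell dvd f - poly \<Psi> ?x2"
  proof -
    have "poly \<Psi> ?x2 = insertion_hom const
      (case_sum (\<lambda>i. if i = 1 then const c * ?x2 else ?x2) (\<lambda>j. variable (Inr j))) f"
      unfolding \<Psi>_def hom_insertion_hom[OF unital_hom_poly]
      by (rule arg_cong3[where f = insertion_hom]) (auto simp: fun_eq_iff mult.commute split: sum.splits)
    moreover have "ell dvd insertion_hom const variable f - insertion_hom const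
      (case_sum (\<lambda>i. if i = 1 then const c * ?x2 else ?x2) (\<lambda>j. variable (Inr j))) f"
    proof (rule dvd_insertion_hom_diff)
      fix i :: "2 + 'n"
      show "ell dvd variable i - (case_sum (\<lambda>i. if i = 1 then const c * ?x2 else ?x2) (\<lambda>j. variable (Inr j))) i"
      proof (cases i)
        case (Inl k)
        then show ?thesis using exhaust_2[of k] by (auto simp: ell_def)
      qed auto
    qed
    ultimately show ?thesis by (simp add: insertion_hom_const_variable)
  qed
  have summand: "\<exists>g\<in>vanishing_ideal X. ell dvd coeff \<Psi> d * ?x2 ^ d - g" for d
  proof -
    define S where "S = \<Union>{fibre R | R. R \<in> snd ` X \<and> card (fibre R) \<le> d}"
    have fin: "finite {fibre R | R. R \<in> snd ` X \<and> card (fibre R) \<le> d}"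
      using finite_X by simp
    have card_S: "card S \<le> d" unfolding S_def
      by (rule card_Union_chain_le[OF fin]) (use fibre_chain in auto)
    define u where "u = (\<lambda>P. SOME u. represents u (P :: ('k, 2) proj))"
    have u: "represents (u P) P" for P unfolding u_def by (rule someI_ex[OF represents_exists])
    \<comment> \<open>The multiple of \<open>ell\<close> is chosen so that \<open>h P\<close> vanishes at \<open>P\<close>.\<close>
    define h where "h P = ?x2 - const (u P $ 2 / (u P $ 1 - c * u P $ 2)) * ell" for P
    define H where "H = (\<Prod>P\<in>S. h P) * ?x2 ^ (d - card S)"
    have "ell dvd (\<Prod>P\<in>S. ?x2) - (\<Prod>P\<in>S. h P)"
      by (rule dvd_prod_diff) (simp add: h_def)
    then have "ell dvd ((\<Prod>P\<in>S. ?x2) - (\<Prod>P\<in>S. h P)) * ?x2 ^ (d - card S)" by (rule dvd_mult2)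
    then have "ell dvd ?x2 ^ d - H"
      using card_S by (simp add: H_def left_diff_distrib power_add[symmetric])
    then have "ell dvd coeff \<Psi> d * (?x2 ^ d - H)" by (rule dvd_mult)
    moreover have "coeff \<Psi> d * H \<in> vanishing_ideal X"
    proof -
      have "eval_bipoly (coeff \<Psi> d * H) w v = 0" if X: "(P, R) \<in> X" and w: "represents w P" and v: "represents v R" for P R w v
      proof -
        interpret ev: unital_hom "\<lambda>g. eval_bipoly g w v" by (rule unital_hom_eval)
        show ?thesis
        proof (cases "P \<in> S")
          case True
          obtain s where s: "w = s *s u P" using represents_unique[OF u w] by blast
          have "eval_bipoly (h P) w v = w $ 2 - u P $ 2 / (u P $ 1 - c * u P $ 2) * (w $ 1 - c * w $ 2)"
            by (simp add: h_def ev.hom_diff ev.hom_mult eval_variable eval_const eval_ell)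
          also have "w $ 1 - c * w $ 2 = (u P $ 1 - c * u P $ 2) * s"
            by (simp add: s algebra_simps)
          finally have "eval_bipoly (h P) w v = 0"
            using c_generic[OF X u] by (simp add: s)
          moreover have "finite S" using True fin finite_fibre by (auto simp: S_def)
          ultimately show ?thesis using True
            by (auto simp: H_def ev.hom_mult ev.hom_prod)
        next
          case False
          have R: "R \<in> snd ` X" using X by force
          have "\<not> card (fibre R) \<le> d"
          proof
            assume "card (fibre R) \<le> d"
            then have "fibre R \<subseteq> S" using R by (auto simp: S_def)
            then show False using False X by (auto simp: fibre_def)
          qed
          then show ?thesis using coeff_vanish[OF R v] by (simp add: ev.hom_mult)
        qed
      qed
      then show ?thesis by (auto simp: vanishing_ideal_eq vanishes_at_def)
    qed
    ultimately show ?thesis by (auto simp: right_diff_distrib intro!: bexI)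
  qed
  then obtain g where g: "\<And>d. g d \<in> vanishing_ideal X" "\<And>d. ell dvd coeff \<Psi> d * ?x2 ^ d - g d" by metis
  have "f - (\<Sum>d\<le>degree \<Psi>. g d) = (f - poly \<Psi> ?x2) + (\<Sum>d\<le>degree \<Psi>. coeff \<Psi> d * ?x2 ^ d - g d)"
    by (simp add: poly_altdef sum_subtractf)
  moreover have "ell dvd (\<Sum>d\<le>degree \<Psi>. coeff \<Psi> d * ?x2 ^ d - g d)" using g(2) by (intro dvd_sum) auto
  ultimately have "ell dvd f - (\<Sum>d\<le>degree \<Psi>. g d)" using ell_dvd by (simp only: dvd_add)
  moreover have "(\<Sum>d\<le>degree \<Psi>. g d) \<in> vanishing_ideal X"
    by (rule ideal_class_sum[OF ideal_vanishing_ideal g(1)])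
  ultimately show ?thesis by blast
qed

end

lemma generic_line_exists:
  fixes X :: "('k::field_char_0, 'n::finite) bipoint set"
  assumes "finite X" "property_star X"
  shows "\<exists>c. generic_line X c"
proof -
  define u where "u = (\<lambda>P. SOME u. represents u (P :: ('k, 2) proj))"
  have u: "represents (u P) P" for P unfolding u_def by (rule someI_ex[OF represents_exists])
  have "finite ((\<lambda>(P, R). u P $ 1 / u P $ 2) ` X)" using assms(1) by simp
  then obtain c where c: "c \<notin> (\<lambda>(P, R). u P $ 1 / u P $ 2) ` X"
    using ex_new_if_finite[OF infinite_UNIV_char_0] by blast
  have "w $ 1 \<noteq> c * w $ 2" if X: "(P, R) \<in> X" and w: "represents w P" for P R w
  proof -
    obtain s where s: "s \<noteq> 0" "w = s *s u P" using represents_unique[OF u w] by blast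
    have "u P $ 1 \<noteq> c * u P $ 2"
    proof (cases "u P $ 2 = 0")
      case True
      have "u P \<noteq> 0" using u[of P] by (simp add: represents_def)
      then show ?thesis using True by (simp add: vec_eq_iff forall_2)
    next
      case False
      moreover have "c \<noteq> u P $ 1 / u P $ 2" using c X by force
      ultimately show ?thesis by (auto simp: field_simps)
    qed
    then show ?thesis using s by (simp add: mult.left_commute)
  qed
  then have "generic_line X c" by unfold_locales (use assms in auto)
  then show ?thesis ..
qed

lemma depth_ge_2:
  fixes X :: "('k::field_char_0, 'n::finite) bipoint set"
  assumes "finite X" "X \<noteq> {}" "property_star X"
  shows "2 \<le> depth_wrt (coord_ring Quot vanishing_ideal X)
    ((\<lambda>f. vanishing_ideal X +>\<^bsub>coord_ring\<^esub> f) ` irrelevant_ideal)"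
proof -
  interpret class_quotient "vanishing_ideal X" by (rule class_quotient.intro[OF ideal_vanishing_ideal])
  obtain c where "generic_line X c" using generic_line_exists[OF assms(1,3)] ..
  then interpret generic_line X c .
  define v where "v = (\<lambda>R. SOME v. represents v (R :: ('k, 'n) proj))"
  have v: "represents (v R) R" for R unfolding v_def by (rule someI_ex[OF represents_exists])
  have "finite ((\<lambda>(P, R). v R) ` X)" "0 \<notin> (\<lambda>(P, R). v R) ` X"
    using assms(1) v by (auto simp: represents_def)
  from hyperplane_avoiding_finite[OF this] obtain a
    where a: "\<And>P R. (P, R) \<in> X \<Longrightarrow> (\<Sum>j\<in>UNIV. a $ j * v R $ j) \<noteq> 0" by force
  define m :: "('k, 'n) bipoly" where "m = (\<Sum>j\<in>UNIV. const (a $ j) * variable (Inr j))"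
  have line_restriction_m: "line_restriction w m = [:\<Sum>j\<in>UNIV. a $ j * w $ j:]" for w
    by (simp add: m_def unital_hom.hom_sum[OF unital_hom_line_restriction] unital_hom.hom_mult[OF unital_hom_line_restriction]
      line_restriction_variable unital_hom.hom_sum[OF unital_hom_const_poly] mult.commute)
  have m_unit: "\<exists>b. b \<noteq> 0 \<and> line_restriction w m = [:b:]" if R: "R \<in> snd ` X" "represents w R" for R w
  proof -
    obtain s where s: "s \<noteq> 0" "w = s *s v R" using represents_unique[OF v R(2)] by blast
    have "(\<Sum>j\<in>UNIV. a $ j * w $ j) = s * (\<Sum>j\<in>UNIV. a $ j * v R $ j)"
      by (simp add: s sum_distrib_left mult.left_commute)
    then show ?thesis using a R(1) s(1) by (auto simp: line_restriction_m)
  qed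
  let ?M = "{f :: ('k, 'n) bipoly. eval_bipoly f 0 0 = 0}"
  interpret ev: unital_hom "\<lambda>f :: ('k, 'n) bipoly. eval_bipoly f 0 0" by (rule unital_hom_eval)
  have I_M: "vanishing_ideal X \<subseteq> ?M"
  proof
    fix f assume f: "f \<in> vanishing_ideal X"
    obtain P R where PR: "(P, R) \<in> X" using assms(2) by auto
    obtain u where u: "represents u P" using represents_exists by blast
    have "cone_map u (v R) f = 0"
      using f PR by (auto simp: vanishing_ideal_eq vanishes_at_iff_cone_map[OF u v])
    then show "f \<in> ?M" using poly_cone_map[of u "v R" f 0 0] by simp
  qed
  have reg: "regular_sequence Q [proj_Q ell, proj_Q m]"
  proof (rule regular_pair[OF ell_cancel ideal_fibre_order_ideal vanishing_ideal_subset_fibre_order_ideal ell_mem_fibre_order_ideal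
        fibre_order_ideal_subset _ ev.ideal_kernel I_M])
    show "y \<in> fibre_order_ideal" if "m * y \<in> fibre_order_ideal" for y
      using fibre_order_ideal_cancel[OF m_unit that] .
    show "m \<in> ?M"
      by (simp add: m_def ev.hom_sum ev.hom_mult eval_variable)
  qed (simp_all add: eval_ell ev.hom_1)
  have irr: "ideal (irrelevant_ideal :: ('k, 'n) bipoly set) coord_ring"
    unfolding irrelevant_ideal_def
    by (rule ring.genideal_ideal[OF cring_class.ring_axioms]) (simp add: carrier_class subset_iff)
  have "range variable \<subseteq> (irrelevant_ideal :: ('k, 'n) bipoly set)"
    unfolding irrelevant_ideal_def
    by (rule ring.genideal_self[OF cring_class.ring_axioms]) (simp add: carrier_class subset_iff)
  then have var: "variable i \<in> (irrelevant_ideal :: ('k, 'n) bipoly set)" for i by auto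
  have "ell \<in> irrelevant_ideal"
    unfolding ell_def by (intro ideal_class_diff[OF irr] ideal_class_mult[OF irr] var)
  moreover have "m \<in> irrelevant_ideal"
    unfolding m_def by (intro ideal_class_sum[OF irr] ideal_class_mult[OF irr] var)
  ultimately have "set [proj_Q ell, proj_Q m] \<subseteq> (\<lambda>f. vanishing_ideal X +>\<^bsub>coord_ring\<^esub> f) ` irrelevant_ideal"
    by (auto simp: proj_Q_def)
  from regular_sequence_length_le_depth[OF reg this] show ?thesis
    by (simp add: numeral_eq_enat numeral_2_eq_2)
qed

theorem theorem1p2:
  fixes n :: nat
    and X :: "('k::{alg_closed_field, field_char_0}, 'n::finite) bipoint set"
  assumes "n \<ge> 1"
    and "CARD('n) = n + 1"
    and "finite X"
    and "X \<noteq> {}"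
    and "property_star X"
  shows "arithmetically_CM X"
proof -
  interpret class_quotient "vanishing_ideal X" by (rule class_quotient.intro[OF ideal_vanishing_ideal])
  note collapse = vanishing_ideal_collapse[OF assms(3)]
  show ?thesis
    unfolding arithmetically_CM_def Let_def
    using krull_dim_le_2[OF collapse] krull_dim_ge_2[OF assms(4)]
      depth_le_2[OF collapse] depth_ge_2[OF assms(3-5)] by (simp add: order_antisym)
qed

end
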